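(* Let $Y=\{Y(t),\ t\in[0,1]\}$ be the unique solution of the functional boundary value problem $$DY(t)+A(t)Y(t)=\dot B(t),\quad t\in[0,1],\qquad \Lambda[Y]=c,$$ where $A$, $B$, $\Lambda$ and $c$ are as described in the context, $\Lambda$ is written in basic form, and the problem is well-posed (i.e. the homogeneous problem $DY+AY=0$, $\Lambda[Y]=0$ has only the trivial solution). Fix $0\le a<b\le 1$ such that $a,b\notin\operatorname{supp}\Lambda$. Let $\mathcal{G}$ be the $\sigma$-field generated by $Y(a)$, $Y(b)$ and all variables $Y_n(t)$ with $t\in\operatorname{supp}\Lambda_i\cap(a,b)$ for some $\Lambda_i$ not preserving $(a,b)$. Then the $\sigma$-fields $$\sigma\{Y(t),\ t\in[a,b]\}\quad\text{and}\quad\sigma\{Y(t),\ t\in[0,1]\setminus(a,b)\}$$ are conditionally independent given $\mathcal{G}$. The same holds true if, in the definition of $\mathcal{G}$, the open interval $(a,b)$ in $\operatorname{supp}\Lambda_i\cap(a,b)$ is replaced by $[0,1]\setminus[a,b]$.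
   Context: Let $n\ge 1$, let $a_0,\dots,a_{n-1}$ be continuous real functions on $[0,1]$, and let $A(t)$ be the $n\times n$ matrix whose first row is $(a_{n-1}(t),a_{n-2}(t),\dots,a_0(t))$, whose entries in positions $(i+1,i)$, $1\le i\le n-1$, are $-1$, and whose remaining entries are $0$. Let $W=\{W(t),\ t\in[0,1]\}$ be the coordinate process on the classical Wiener space ($\Omega=C_0([0,1];\mathbb{R})$, the continuous functions vanishing at $0$, with its Borel $\sigma$-field and Wiener measure $P$), so $W$ is a standard Wiener process, and put $B(t)=(W(t),0,\dots,0)\in\mathbb{R}^n$. (The system is the first order form of an $n$-th order equation $L[X]=\dot W$, $L=D^n+a_{n-1}D^{n-1}+\cdots+a_0$, $D=d/dt$, with $Y_i=D^{n-i}X$, so $Y_n=X$.) Boundary operator: let $m\ge n$, let $0\le t_1<\dots<t_m\le 1$, let $(\alpha_{ij})$ be a real $n\times m$ matrix of full rank $n$, and let $c\in\mathbb{R}^n$. $\Lambda=(\Lambda_1,\dots,\Lambda_n)$ is given by $\Lambda_i[Y]=\sum_{j=1}^m\alpha_{ij}Y_n(t_j)$, where $Y_n$ is the last component of $Y$. Put $\operatorname{supp}\Lambda_i=\{t_j:\alpha_{ij}\ne0\}$ and $\operatorname{supp}\Lambda=\bigcup_i\operatorname{supp}\Lambda_i$. Basic form: $\Lambda$ is written in basic form if there are $n$ columns of $(\alpha_{ij})$ forming (up to a permutation of the columns) the $n\times n$ identity matrix. Any full rank condition can be put in this form by multiplying $(\alpha_{ij})$ and $c$ on the left by the inverse of an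 invertible $n\times n$ submatrix. Solution: under well-posedness, for every $\omega\in\Omega$ the path $Y(\cdot)(\omega)$ is the unique continuous function $[0,1]\to\mathbb{R}^n$ with $Y(t)-Y(0)+\int_0^tA(s)Y(s)\,ds=B(t)$ for all $t\in[0,1]$ and $\Lambda[Y]=c$. Preservation: $\Lambda_i$ preserves the pair $(a,b)$ if either $\operatorname{supp}\Lambda_i\subset(a,b)$ (open interval) or $\operatorname{supp}\Lambda_i\subset[0,1]\setminus[a,b]$. *)

theory Defs
  imports "HOL-Probability.Probability"
begin

definition standard_wiener_process :: "'a measure \<Rightarrow> (real \<Rightarrow> 'a \<Rightarrow> real) \<Rightarrow> bool" where
  "standard_wiener_process M W \<longleftrightarrow>
     prob_space M \<and>
     (\<forall>t\<in>{0..1}. W t \<in> borel_measurable M) \<and>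
     (AE \<omega> in M. W 0 \<omega> = 0) \<and>
     (AE \<omega> in M. continuous_on {0..1} (\<lambda>t. W t \<omega>)) \<and>
     (\<forall>s t. 0 \<le> s \<longrightarrow> s < t \<longrightarrow> t \<le> 1 \<longrightarrow>
        distributed M lborel (\<lambda>\<omega>. W t \<omega> - W s \<omega>) (normal_density 0 (sqrt (t - s)))) \<and>
     (\<forall>(k::nat) (\<tau>::nat \<Rightarrow> real). mono_on {..k} \<tau> \<longrightarrow> \<tau> ` {..k} \<subseteq> {0..1} \<longrightarrow>
        prob_space.indep_vars M (\<lambda>_. borel) (\<lambda>i \<omega>. W (\<tau> (Suc i)) \<omega> - W (\<tau> i) \<omega>) {..<k})"

text \<open>
  The space of continuous functions on $[0,1]$ vanishing at $0$, with the supremum metric. As usual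
  for \<^const>\<open>cfunspace\<close>, the functions are extensional, that is, \<^const>\<open>undefined\<close> off $[0,1]$.
\<close>
definition C0_metric :: "(real \<Rightarrow> real) metric" where
  "C0_metric = submetric (cfunspace (top_of_set {0..1}) euclidean_metric) {\<omega>. \<omega> 0 = 0}"

text \<open>
  The Wiener measure is determined by this property: it is the Borel measure on the space of paths
  that makes the coordinate process a standard Wiener process.
\<close>
definition wiener_measure :: "(real \<Rightarrow> real) measure \<Rightarrow> bool" where
  "wiener_measure P \<longleftrightarrow>
     space P = mspace C0_metric \<and>
     sets P = sigma_sets (mspace C0_metric) {U. openin (mtopology_of C0_metric) U} \<and>
     standard_wiener_process P (\<lambda>t \<omega>. \<omega> t)"

definition generators ::
    "'a set \<Rightarrow> ('i \<Rightarrow> 'a \<Rightarrow> 'b::topological_space) \<Rightarrow> 'i set \<Rightarrow> 'a set set" where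
  "generators \<Omega> X I = {X i -` S \<inter> \<Omega> | i S. i \<in> I \<and> S \<in> sets borel}"

text \<open>
  The inclusion of the three \<open>\<sigma>\<close>-fields in that of \<open>M\<close> is part of the notion: \<^const>\<open>real_cond_exp\<close> is
  a conditional expectation only under \<^prop>\<open>subalgebra M G\<close>.
\<close>
definition cond_indep :: "'a measure \<Rightarrow> 'a measure \<Rightarrow> 'a measure \<Rightarrow> 'a measure \<Rightarrow> bool" where
  "cond_indep M G F H \<longleftrightarrow>
     subalgebra M G \<and> subalgebra M F \<and> subalgebra M H \<and>
     (\<forall>A\<in>sets F. \<forall>B\<in>sets H. AE \<omega> in M.
        real_cond_exp M G (indicator (A \<inter> B)) \<omega> =
        real_cond_exp M G (indicator A) \<omega> * real_cond_exp M G (indicator B) \<omega>)"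

text \<open>
  The dimension $n$ is the cardinality of a finite, linearly ordered index type; \<open>pos\<close> numbers its
  elements $1, \dots, n$ in increasing order.
\<close>
definition pos :: "'n::{finite,linorder} \<Rightarrow> nat" where
  "pos i = card {..i}"

definition last_comp :: "real ^ 'n::{finite,linorder} \<Rightarrow> real" where
  "last_comp y = y $ Max UNIV"

definition companion_matrix :: "(nat \<Rightarrow> real \<Rightarrow> real) \<Rightarrow> real \<Rightarrow> real ^ 'n::{finite,linorder} ^ 'n::{finite,linorder}" where
  "companion_matrix a s = (\<chi> i j.
     if pos i = 1 then a (CARD('n) - pos j) s
     else if pos i = pos j + 1 then - 1
     else 0)"

definition forcing :: "(real \<Rightarrow> real) \<Rightarrow> real \<Rightarrow> real ^ 'n::{finite,linorder}" where
  "forcing w s = (\<chi> i. if pos i = 1 then w s else 0)"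

definition boundary_op ::
    "real ^ 'm ^ 'n::{finite,linorder} \<Rightarrow> ('m \<Rightarrow> real) \<Rightarrow> (real \<Rightarrow> real ^ 'n::{finite,linorder}) \<Rightarrow> real ^ 'n::{finite,linorder}" where
  "boundary_op \<alpha> t y = (\<chi> i. \<Sum>j\<in>UNIV. \<alpha> $ i $ j * last_comp (y (t j)))"

definition basic_form :: "real ^ 'm ^ 'n \<Rightarrow> bool" where
  "basic_form \<alpha> \<longleftrightarrow> (\<exists>f :: 'n \<Rightarrow> 'm. inj f \<and> (\<chi> i k. \<alpha> $ i $ f k) = mat 1)"

definition bvp_solution ::
    "(real \<Rightarrow> real ^ 'n ^ 'n) \<Rightarrow> (real \<Rightarrow> real ^ 'n) \<Rightarrow> ((real \<Rightarrow> real ^ 'n) \<Rightarrow> real ^ 'n) \<Rightarrow> real ^ 'n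
      \<Rightarrow> (real \<Rightarrow> real ^ 'n) \<Rightarrow> bool" where
  "bvp_solution A B \<Lambda> c y \<longleftrightarrow>
     continuous_on {0..1} y \<and>
     (\<forall>t\<in>{0..1}. y t - y 0 + integral {0..t} (\<lambda>s. A s *v y s) = B t) \<and>
     \<Lambda> y = c"

definition well_posed ::
    "(real \<Rightarrow> real ^ 'n ^ 'n) \<Rightarrow> ((real \<Rightarrow> real ^ 'n) \<Rightarrow> real ^ 'n) \<Rightarrow> bool" where
  "well_posed A \<Lambda> \<longleftrightarrow> (\<forall>y. bvp_solution A (\<lambda>_. 0) \<Lambda> 0 y \<longrightarrow> (\<forall>t\<in>{0..1}. y t = 0))"

definition supp :: "real ^ 'm ^ 'n \<Rightarrow> ('m \<Rightarrow> real) \<Rightarrow> 'n \<Rightarrow> real set" where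
  "supp \<alpha> t i = {t j | j. \<alpha> $ i $ j \<noteq> 0}"

definition preserves :: "real set \<Rightarrow> real \<Rightarrow> real \<Rightarrow> bool" where
  "preserves S a b \<longleftrightarrow> S \<subseteq> {a<..<b} \<or> S \<subseteq> {0..1} - {a..b}"

definition splitting_times ::
    "real ^ 'm ^ 'n \<Rightarrow> ('m \<Rightarrow> real) \<Rightarrow> real \<Rightarrow> real \<Rightarrow> real set \<Rightarrow> real set" where
  "splitting_times \<alpha> t a b D = (\<Union>i\<in>{i. \<not> preserves (supp \<alpha> t i) a b}. supp \<alpha> t i \<inter> D)"

definition boundary_field ::
    "'a set \<Rightarrow> (real \<Rightarrow> 'a \<Rightarrow> real ^ 'n::{finite,linorder}) \<Rightarrow> real \<Rightarrow> real \<Rightarrow> real set \<Rightarrow> 'a measure" where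
  "boundary_field \<Omega> Y a b T =
     sigma \<Omega> (generators \<Omega> Y {a, b} \<union> generators \<Omega> (\<lambda>t \<omega>. last_comp (Y t \<omega>)) T)"

end

theory Submission
  imports Defs
begin

text \<open>
  The only probabilistic input is the independence of the increments of \<open>W\<close> inside \<open>[a,b]\<close> from
  those outside. By variation of constants, pathwise, \<open>Y(r)\<close> is a deterministic linear
  function of the state at an anchor point \<open>s(r)\<close> (\<open>a\<close> for \<open>r \<le> b\<close>, otherwise \<open>b\<close>) plus a noise
  term \<open>Z(r)\<close> that depends only on the increments of \<open>W\<close> between \<open>s(r)\<close> and \<open>r\<close>. Hence, modulo
  \<open>Y(a)\<close> and \<open>Y(b)\<close>, each boundary condition expresses the sum of an inner noise functional and an
  outer one. The values of \<open>Y\<^sub>n\<close> included in \<open>\<G>\<close> make both summands \<open>\<G>\<close>-measurable; conversely, by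
  well-posedness \<open>Y(a)\<close> is recovered from them. So \<open>\<G>\<close> is generated by a \<open>\<sigma>\<close>-field \<open>\<G>\<^sub>1\<close> of inner
  noise and a \<open>\<sigma>\<close>-field \<open>\<G>\<^sub>2\<close> of outer noise. Given their join, inner noise (with \<open>\<G>\<^sub>2\<close>) and outer
  noise (with \<open>\<G>\<^sub>1\<close>) are conditionally independent.
\<close>

section \<open>Conditional independence from independence\<close>

text \<open>Dynkin's argument: the sets on which the two set integrals agree are closed under
  countable disjoint unions and, because \<open>space M\<close> lies in \<open>E\<close>, under
  complements. Agreement on an Int-stable generator therefore suffices.\<close>

lemma set_integral_eq_sigma_sets:
  fixes f g :: "'a \<Rightarrow> real"
  assumes f: "integrable M f" and g: "integrable M g"
    and E: "E \<subseteq> sets M" "Int_stable E" "space M \<in> E"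
    and eq: "\<And>A. A \<in> E \<Longrightarrow> (LINT x:A|M. f x) = (LINT x:A|M. g x)"
    and A: "A \<in> sigma_sets (space M) E"
  shows "(LINT x:A|M. f x) = (LINT x:A|M. g x)"
proof -
  have sub: "sigma_sets (space M) E \<subseteq> sets M"
    using E(1) by (rule sets.sigma_sets_subset)
  have int: "set_integrable M B h" if "B \<in> sets M" "integrable M h" for B and h :: "'a \<Rightarrow> real"
    unfolding set_integrable_def using that by (rule integrable_mult_indicator)
  have E': "E \<subseteq> Pow (space M)"
    using E(1) sets.space_closed by blast
  show ?thesis
    using E(2) E' A
  proof (induction rule: sigma_sets_induct_disjoint)
    case (basic A)
    then show ?case by (rule eq)
  next
    case empty
    show ?case by (simp add: set_lebesgue_integral_def)
  next
    case (compl A)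
    have A: "A \<in> sets M" using compl sub by auto
    have "(LINT x:space M|M. h x) = (LINT x:A|M. h x) + (LINT x:space M - A|M. h x)"
      if "integrable M h" for h :: "'a \<Rightarrow> real"
    proof -
      have "space M = A \<union> (space M - A)" using sets.sets_into_space[OF A] by auto
      then show ?thesis
        using set_integral_Un[of A "space M - A" M h] int[OF _ that] A by auto
    qed
    from this[OF f] this[OF g] eq[OF E(3)] compl.IH show ?case by simp
  next
    case (union A)
    have A: "A i \<in> sets M" for i using union sub by auto
    have *: "(LINT x:(\<Union>i. A i)|M. h x) = (\<Sum>i. (LINT x:(A i)|M. h x))"
      if "integrable M h" for h :: "'a \<Rightarrow> real"
      by (rule lebesgue_integral_countable_add)
         (use A union(1) int[OF _ that] in \<open>auto simp: disjoint_family_on_def\<close>)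
    show ?case using *[OF f] *[OF g] union.IH by simp
  qed
qed

text \<open>Intersections of members, rather than the members themselves, serve as generators: for
  equal spaces they generate the same sigma-field, and they form an Int-stable family to which
  Dynkin's argument applies at once.\<close>

definition join_field :: "'a measure \<Rightarrow> 'a measure \<Rightarrow> 'a measure" where
  "join_field N K = sigma (space N) {A \<inter> C | A C. A \<in> sets N \<and> C \<in> sets K}"

lemma
  assumes "space K = space N"
  shows space_join_field: "space (join_field N K) = space N"
    and sets_join_field: "sets (join_field N K) =
      sigma_sets (space N) {A \<inter> C | A C. A \<in> sets N \<and> C \<in> sets K}"
    and join_field_left: "sets N \<subseteq> sets (join_field N K)"
    and join_field_right: "sets K \<subseteq> sets (join_field N K)"
proof -
  have sub: "{A \<inter> C | A C. A \<in> sets N \<and> C \<in> sets K} \<subseteq> Pow (space N)"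
    using sets.sets_into_space[of _ N] by auto
  show "space (join_field N K) = space N"
    unfolding join_field_def using sub by (rule space_measure_of)
  show *: "sets (join_field N K) =
      sigma_sets (space N) {A \<inter> C | A C. A \<in> sets N \<and> C \<in> sets K}"
    unfolding join_field_def using sub by (rule sets_measure_of)
  show "sets N \<subseteq> sets (join_field N K)"
  proof
    fix A assume A: "A \<in> sets N"
    then have "A = A \<inter> space K" using sets.sets_into_space[of A N] assms by auto
    with A show "A \<in> sets (join_field N K)" unfolding *
      by (intro sigma_sets.Basic) blast
  qed
  show "sets K \<subseteq> sets (join_field N K)"
  proof
    fix A assume A: "A \<in> sets K"
    then have "A = space N \<inter> A" using sets.sets_into_space[of A K] assms by auto
    with A show "A \<in> sets (join_field N K)" unfolding *
      by (intro sigma_sets.Basic) blast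
  qed
qed

lemma subalgebra_trans: "subalgebra M N \<Longrightarrow> subalgebra N K \<Longrightarrow> subalgebra M K"
  by (auto simp: subalgebra_def)

lemma subalgebra_join_field:
  assumes "subalgebra L N" "subalgebra L K"
  shows "subalgebra L (join_field N K)"
proof -
  have sp: "space K = space N" and spL: "space N = space L" using assms by (auto simp: subalgebra_def)
  have "{A \<inter> C | A C. A \<in> sets N \<and> C \<in> sets K} \<subseteq> sets L"
    using assms unfolding subalgebra_def by blast
  then have "sets (join_field N K) \<subseteq> sets L"
    unfolding sets_join_field[OF sp] spL by (rule sets.sigma_sets_subset)
  then show ?thesis
    using space_join_field[OF sp] spL by (simp add: subalgebra_def)
qed

lemma
  assumes "space K = space N"
  shows subalgebra_join_field_left: "subalgebra (join_field N K) N"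
    and subalgebra_join_field_right: "subalgebra (join_field N K) K"
  using space_join_field[OF assms] join_field_left[OF assms] join_field_right[OF assms] assms
  by (simp_all add: subalgebra_def)

lemma Int_stable_join: "Int_stable {A \<inter> C | A C. A \<in> sets N \<and> C \<in> sets K}"
proof (rule Int_stableI, clarify)
  fix A C A' C' assume "A \<in> sets N" "C \<in> sets K" "A' \<in> sets N" "C' \<in> sets K"
  then show "\<exists>A'' C''. A \<inter> C \<inter> (A' \<inter> C') = A'' \<inter> C'' \<and> A'' \<in> sets N \<and> C'' \<in> sets K"
    by (intro exI[of _ "A \<inter> A'"] exI[of _ "C \<inter> C'"]) auto
qed

text \<open>Identities between integrals over events of a join need testing only on intersections
  \<open>A \<inter> C\<close>, where independence can be used.\<close>

lemma set_integral_eq_join_field: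
  fixes f g :: "'a \<Rightarrow> real"
  assumes f: "integrable M f" and g: "integrable M g"
    and sub: "subalgebra M N" "subalgebra M K"
    and eq: "\<And>A C. A \<in> sets N \<Longrightarrow> C \<in> sets K \<Longrightarrow> (LINT x:A \<inter> C|M. f x) = (LINT x:A \<inter> C|M. g x)"
    and A: "A \<in> sets (join_field N K)"
  shows "(LINT x:A|M. f x) = (LINT x:A|M. g x)"
proof (rule set_integral_eq_sigma_sets[OF f g _ Int_stable_join[of N K]])
  have sp: "space N = space M" "space K = space M" using sub by (auto simp: subalgebra_def)
  show "{A \<inter> C | A C. A \<in> sets N \<and> C \<in> sets K} \<subseteq> sets M"
    using sub by (auto simp: subalgebra_def)
  have "space N \<in> sets N" "space K \<in> sets K" by auto
  then show "space M \<in> {A \<inter> C | A C. A \<in> sets N \<and> C \<in> sets K}"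
    using sp by auto
  show "A \<in> sigma_sets (space M) {A \<inter> C | A C. A \<in> sets N \<and> C \<in> sets K}"
    using A sets_join_field[of K N] sp by simp
qed (use eq in auto)

lemma (in prob_space) indep_set_mono:
  assumes indep: "indep_set A B" and "A' \<subseteq> A" "B' \<subseteq> B"
  shows "indep_set A' B'"
  using indep_setD_ev1[OF indep] indep_setD_ev2[OF indep] indep_setD[OF indep] assms(2,3)
  unfolding indep_sets2_eq by (metis subset_trans subsetD)

text \<open>The indicator of \<open>A\<close> and \<open>f\<close> generate sub-sigma-fields of the
  independent \<open>N\<close> and \<open>K\<close>, so the expectation of their product
  factorises.\<close>

lemma (in prob_space) set_integral_indep:
  fixes f :: "'a \<Rightarrow> real"
  assumes indep: "indep_set (sets N) (sets K)" and sub: "subalgebra M N" "subalgebra M K"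
    and A: "A \<in> sets N" and f: "integrable M f" "f \<in> borel_measurable K"
  shows "(LINT x:A|M. f x) = prob A * (LINT x|M. f x)"
proof -
  have sp: "space N = space M" "space K = space M" using sub by (auto simp: subalgebra_def)
  have AM: "A \<in> sets M" using A sub by (auto simp: subalgebra_def)
  have "indep_var borel (indicator A :: 'a \<Rightarrow> real) borel f"
    unfolding indep_var_eq
  proof (intro conjI)
    show "random_variable borel (indicator A :: 'a \<Rightarrow> real)" "random_variable borel f"
      using AM f(1) by auto
    have "{indicator A -` S \<inter> space M | S. S \<in> sets (borel::real measure)} \<subseteq> sets N"
      using A sp measurable_sets[of "indicator A :: 'a \<Rightarrow> real" N borel] by auto
    then have 1: "sigma_sets (space M) {indicator A -` S \<inter> space M | S. S \<in> sets (borel::real measure)} \<subseteq> sets N"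
      by (rule sets.sigma_sets_subset[of _ N, unfolded sp])
    have "{f -` S \<inter> space M | S. S \<in> sets borel} \<subseteq> sets K"
      using measurable_sets[OF f(2)] unfolding sp(2) by blast
    then have 2: "sigma_sets (space M) {f -` S \<inter> space M | S. S \<in> sets borel} \<subseteq> sets K"
      by (rule sets.sigma_sets_subset[of _ K, unfolded sp])
    show "indep_set (sigma_sets (space M) {indicator A -` S \<inter> space M | S. S \<in> sets (borel::real measure)})
        (sigma_sets (space M) {f -` S \<inter> space M | S. S \<in> sets borel})"
      by (rule indep_set_mono[OF indep 1 2])
  qed
  from indep_var_lebesgue_integral[OF this integrable_real_indicator f(1)] AM
  have "(LINT x|M. indicator A x * f x) = (LINT x|M. indicator A x) * (LINT x|M. f x)"
    by (simp add: emeasure_eq_measure)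
  then show ?thesis using AM by (simp add: set_lebesgue_integral_def)
qed

lemma set_integral_Int:
  fixes f :: "'a \<Rightarrow> real"
  shows "(LINT x:A \<inter> C|M. f x) = (LINT x:A|M. indicator C x * f x)"
  by (simp add: set_lebesgue_integral_def indicator_inter_arith mult.assoc)

text \<open>Since \<open>G\<close> lies in \<open>join_field N2 G1\<close>, it suffices that
  conditioning an event of \<open>join_field N1 G2\<close> on \<open>join_field N2 G1\<close> yields
  no more than conditioning it on \<open>G\<close> (\<open>step3\<close>). By the symmetry of
  conditional expectation this follows from its dual: an event of \<open>N2\<close>, conditioned on
  \<open>join_field N1 G2\<close>, depends on \<open>G2\<close> only (\<open>step2\<close>).\<close>

lemma (in prob_space) cond_indep_join_field:
  assumes indep: "indep_set (sets N1) (sets N2)"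
    and N: "subalgebra M N1" "subalgebra M N2"
    and G12: "subalgebra N1 G1" "subalgebra N2 G2"
    and G: "space G = space M" "sets G = sets (join_field G1 G2)"
    and F: "subalgebra (join_field N1 G2) F"
    and H: "subalgebra (join_field N2 G1) H"
  shows "cond_indep M G F H"
proof -
  have sp: "space N1 = space M" "space N2 = space M" "space G1 = space M" "space G2 = space M"
    using N G12 by (auto simp: subalgebra_def)
  have subM: "subalgebra M G1" "subalgebra M G2"
    using subalgebra_trans[OF N(1) G12(1)] subalgebra_trans[OF N(2) G12(2)] .
  have G': "subalgebra L G \<longleftrightarrow> subalgebra L (join_field G1 G2)" for L
    using G space_join_field[of G2 G1] sp by (simp add: subalgebra_def)
  have G12': "sets G1 \<subseteq> sets G" "sets G2 \<subseteq> sets G"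
    using join_field_left[of G2 G1] join_field_right[of G2 G1] sp G(2) by simp_all
  have sGM: "subalgebra M G"
    unfolding G' by (rule subalgebra_join_field[OF subM])
  have FJM: "subalgebra M (join_field N1 G2)"
    by (rule subalgebra_join_field[OF N(1) subM(2)])
  have HJM: "subalgebra M (join_field N2 G1)"
    by (rule subalgebra_join_field[OF N(2) subM(1)])
  have FM: "sets (join_field N1 G2) \<subseteq> sets M" and HM: "sets (join_field N2 G1) \<subseteq> sets M"
    using FJM HJM by (simp_all add: subalgebra_def)
  have sF: "sets F \<subseteq> sets (join_field N1 G2)" and sH: "sets H \<subseteq> sets (join_field N2 G1)"
    using F H by (simp_all add: subalgebra_def)
  have "subalgebra (join_field N2 G1) G"
    unfolding G'
  proof (rule subalgebra_join_field)
    have e: "space G1 = space N2" using sp by simp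
    show "subalgebra (join_field N2 G1) G1" by (rule subalgebra_join_field_right[OF e])
    show "subalgebra (join_field N2 G1) G2"
      by (rule subalgebra_trans[OF subalgebra_join_field_left[OF e] G12(2)])
  qed
  then have GH: "sets G \<subseteq> sets (join_field N2 G1)"
    by (simp add: subalgebra_def)
  interpret G: finite_measure_subalgebra M G
    by unfold_locales (rule sGM)
  interpret G2: finite_measure_subalgebra M G2
    by unfold_locales (rule subM)
  have inM: "A \<in> sets M" if "A \<in> sets N1 \<or> A \<in> sets N2 \<or> A \<in> sets G1 \<or> A \<in> sets G2" for A
    using that N subM unfolding subalgebra_def by auto
  have ind: "integrable M (indicator A :: _ \<Rightarrow> real)" if "A \<in> sets M" for A
    using that by (simp add: integrable_indicator_iff emeasure_eq_measure)
  have ind_mult: "integrable M (\<lambda>x. indicator A x * f x)"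
    if "A \<in> sets M" "integrable M f" for A and f :: "'a \<Rightarrow> real"
    using integrable_mult_indicator[OF that] by simp
  have set_ind: "(LINT x:A|M. indicator B x) = (LINT x:B|M. indicator A x :: real)" for A B :: "'a set"
    by (simp add: set_lebesgue_integral_def mult.commute)
  \<comment> \<open>By independence, \<open>\<phi> B\<close> is also the conditional expectation of \<open>B\<close> given \<open>G\<close>.\<close>
  define \<phi> where "\<phi> B = real_cond_exp M G2 (indicator B)" for B
  have \<phi>_int: "integrable M (\<phi> B)" if "B \<in> sets N2" for B
    unfolding \<phi>_def using ind inM that by (intro G2.real_cond_exp_int) auto
  have \<phi>_G2 [measurable]: "\<phi> B \<in> borel_measurable G2" for B
    unfolding \<phi>_def by simp
  have \<phi>_G: "\<phi> B \<in> borel_measurable G" for B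
    by (rule measurable_from_subalg[OF _ \<phi>_G2]) (use G12' sp G in \<open>simp add: subalgebra_def\<close>)
  have \<phi>_N2: "\<phi> B \<in> borel_measurable N2" for B
    using measurable_from_subalg[OF G12(2) \<phi>_G2] .
  \<comment> \<open>Independence takes \<open>A\<close> out as the factor \<open>prob A\<close>, for
    \<open>\<phi> B\<close> here and for the indicator of \<open>B\<close> in \<open>prod2\<close>.
    What remains are integrals over \<open>C\<close> in \<open>G2\<close>, where both integrands
    agree by the definition of conditional expectation.\<close>
  have prod1: "(LINT x:A \<inter> C|M. \<phi> B x) = prob A * (LINT x:C|M. \<phi> B x)"
    if "A \<in> sets N1" "C \<in> sets G2" "B \<in> sets N2" for A B C
  proof -
    have C: "C \<in> sets N2" using that G12 unfolding subalgebra_def by auto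
    have "(LINT x:A \<inter> C|M. \<phi> B x) = (LINT x:A|M. indicator C x * \<phi> B x)"
      by (rule set_integral_Int)
    also have "\<dots> = prob A * (LINT x|M. indicator C x * \<phi> B x)"
    proof (rule set_integral_indep[OF indep N that(1)])
      show "integrable M (\<lambda>x. indicator C x * \<phi> B x)"
        using inM that \<phi>_int by (intro ind_mult) auto
      show "(\<lambda>x. indicator C x * \<phi> B x) \<in> borel_measurable N2"
        using C \<phi>_N2[of B] by measurable
    qed
    finally show ?thesis by (simp add: set_lebesgue_integral_def)
  qed
  have prod2: "(LINT x:A \<inter> C|M. indicator B x) = prob A * (LINT x:C|M. indicator B x)"
    if "A \<in> sets N1" "C \<in> sets G2" "B \<in> sets N2" for A B C
  proof -
    have C: "C \<in> sets N2" using that G12 unfolding subalgebra_def by auto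
    have "(LINT x:A \<inter> C|M. indicator B x) = (LINT x:A|M. indicator C x * indicator B x :: real)"
      by (rule set_integral_Int)
    also have "\<dots> = prob A * (LINT x|M. indicator C x * indicator B x)"
    proof (rule set_integral_indep[OF indep N that(1)])
      show "integrable M (\<lambda>x. indicator C x * indicator B x :: real)"
        using inM that ind by (intro ind_mult) auto
      show "(\<lambda>x. indicator C x * indicator B x :: real) \<in> borel_measurable N2"
        using C that by measurable
    qed
    finally show ?thesis by (simp add: set_lebesgue_integral_def)
  qed
  have \<phi>_ind: "(LINT x:C|M. \<phi> B x) = (LINT x:C|M. indicator B x)"
    if "C \<in> sets G2" "B \<in> sets N2" for B C
    unfolding \<phi>_def using G2.real_cond_exp_intA[of "indicator B" C] ind inM that by auto
  have \<phi>_AE: "AE x in M. real_cond_exp M G (indicator B) x = \<phi> B x" if B: "B \<in> sets N2" for B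
  proof (rule G.real_cond_exp_charact)
    fix D assume "D \<in> sets G"
    then have D: "D \<in> sets (join_field G1 G2)" using G by simp
    show "(LINT x:D|M. indicator B x) = (LINT x:D|M. \<phi> B x)"
    proof (rule set_integral_eq_join_field[OF _ _ subM _ D])
      fix A C assume A: "A \<in> sets G1" and C: "C \<in> sets G2"
      have A1: "A \<in> sets N1" using A G12 unfolding subalgebra_def by auto
      show "(LINT x:A \<inter> C|M. indicator B x) = (LINT x:A \<inter> C|M. \<phi> B x)"
        using prod1[OF A1 C B] prod2[OF A1 C B] \<phi>_ind[OF C B] by simp
    qed (use \<phi>_int ind inM B in auto)
  qed (use \<phi>_int \<phi>_G ind inM B in auto)
  \<comment> \<open>On a test set \<open>A1 \<inter> C2\<close> the event \<open>C\<close> of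
    \<open>G1\<close> is absorbed into \<open>A1\<close>, because \<open>G1\<close> is contained in
    \<open>N1\<close>; then \<open>prod1\<close> and \<open>prod2\<close> apply.\<close>
  have step2: "(LINT x:A|M. indicator (B \<inter> C) x) = (LINT x:A|M. indicator C x * \<phi> B x)"
    if A: "A \<in> sets (join_field N1 G2)" and B: "B \<in> sets N2" and C: "C \<in> sets G1" for A B C
  proof (rule set_integral_eq_join_field[OF _ _ N(1) subM(2) _ A])
    show "integrable M (indicator (B \<inter> C) :: _ \<Rightarrow> real)"
      using inM B C by (intro ind) auto
    show "integrable M (\<lambda>x. indicator C x * \<phi> B x)"
      using inM B C \<phi>_int by (intro ind_mult) auto
    fix A1 C2 assume A1: "A1 \<in> sets N1" and C2: "C2 \<in> sets G2"
    have AC: "A1 \<inter> C \<in> sets N1" using A1 C G12 unfolding subalgebra_def by auto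
    have "(LINT x:A1 \<inter> C2|M. indicator (B \<inter> C) x) = (LINT x:(A1 \<inter> C) \<inter> C2|M. indicator B x :: real)"
      unfolding set_lebesgue_integral_def
      by (intro Bochner_Integration.integral_cong) (auto simp: indicator_def)
    also have "\<dots> = (LINT x:(A1 \<inter> C) \<inter> C2|M. \<phi> B x)"
      using prod1[OF AC C2 B] prod2[OF AC C2 B] \<phi>_ind[OF C2 B] by simp
    also have "\<dots> = (LINT x:A1 \<inter> C2|M. indicator C x * \<phi> B x)"
      unfolding set_lebesgue_integral_def
      by (intro Bochner_Integration.integral_cong) (auto simp: indicator_def)
    finally show "(LINT x:A1 \<inter> C2|M. indicator (B \<inter> C) x) = (LINT x:A1 \<inter> C2|M. indicator C x * \<phi> B x)" .
  qed
  have step3: "(LINT x:B|M. indicator A x) = (LINT x:B|M. real_cond_exp M G (indicator A) x)"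
    if A: "A \<in> sets (join_field N1 G2)" and B: "B \<in> sets (join_field N2 G1)" for A B
  proof (rule set_integral_eq_join_field[OF _ _ N(2) subM(1) _ B])
    have AM: "A \<in> sets M" using A FM by auto
    show "integrable M (indicator A :: _ \<Rightarrow> real)" using AM by (rule ind)
    show EA: "integrable M (real_cond_exp M G (indicator A))"
      using ind[OF AM] by (rule G.real_cond_exp_int)
    fix B2 C1 assume B2: "B2 \<in> sets N2" and C1: "C1 \<in> sets G1"
    have B2M: "B2 \<in> sets M" and C1M: "C1 \<in> sets M" using B2 C1 inM by auto
    have C1G: "C1 \<in> sets G" using C1 G12' by auto
    let ?EA = "real_cond_exp M G (indicator A)"
    have "(LINT x:B2 \<inter> C1|M. indicator A x) = (LINT x:A|M. indicator (B2 \<inter> C1) x :: real)"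
      by (rule set_ind)
    also have "\<dots> = (LINT x:A|M. indicator C1 x * \<phi> B2 x)"
      by (rule step2[OF A B2 C1])
    \<comment> \<open>Self-adjointness of conditional expectation in three moves: the
      \<open>G\<close>-measurable factor allows \<open>A\<close> to be replaced by its conditional
      expectation, \<open>\<phi> B2\<close> is recognised as the conditional expectation of
      \<open>B2\<close> given \<open>G\<close>, and the projection is then removed from
      \<open>B2\<close>.\<close>
    also have "\<dots> = (LINT x|M. (indicator C1 x * \<phi> B2 x) * indicator A x)"
      by (simp add: set_lebesgue_integral_def mult_ac)
    also have "\<dots> = (LINT x|M. (indicator C1 x * \<phi> B2 x) * ?EA x)"
    proof (rule G.real_cond_exp_intg(2)[symmetric])
      show "integrable M (\<lambda>x. indicator C1 x * \<phi> B2 x * indicator A x)"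
        using ind_mult[OF AM ind_mult[OF C1M \<phi>_int[OF B2]]] by (simp add: mult_ac)
      show "(\<lambda>x. indicator C1 x * \<phi> B2 x) \<in> borel_measurable G"
        using C1G \<phi>_G[of B2] by measurable
    qed (use AM in simp)
    also have "\<dots> = (LINT x|M. (indicator C1 x * ?EA x) * real_cond_exp M G (indicator B2) x)"
    proof (rule integral_cong_AE)
      show "(\<lambda>x. indicator C1 x * \<phi> B2 x * ?EA x) \<in> borel_measurable M"
        using C1M \<phi>_int[OF B2] EA by measurable
      show "(\<lambda>x. indicator C1 x * ?EA x * real_cond_exp M G (indicator B2) x) \<in> borel_measurable M"
        using C1M EA by measurable
      show "AE x in M. indicator C1 x * \<phi> B2 x * ?EA x =
          indicator C1 x * ?EA x * real_cond_exp M G (indicator B2) x"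
        using \<phi>_AE[OF B2] by eventually_elim simp
    qed
    also have "\<dots> = (LINT x|M. (indicator C1 x * ?EA x) * indicator B2 x)"
    proof (rule G.real_cond_exp_intg(2))
      show "integrable M (\<lambda>x. indicator C1 x * ?EA x * indicator B2 x)"
        using ind_mult[OF B2M ind_mult[OF C1M EA]] by (simp add: mult_ac)
      show "(\<lambda>x. indicator C1 x * ?EA x) \<in> borel_measurable G"
        using C1G by measurable
    qed (use B2M in simp)
    also have "\<dots> = (LINT x:B2 \<inter> C1|M. ?EA x)"
      unfolding set_lebesgue_integral_def
      by (intro Bochner_Integration.integral_cong) (auto simp: indicator_def)
    finally show "(LINT x:B2 \<inter> C1|M. indicator A x) = (LINT x:B2 \<inter> C1|M. ?EA x)" .
  qed
  \<comment> \<open>The product is tested on \<open>D\<close> in \<open>G\<close>. As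
    \<open>D \<inter> B\<close> again lies in \<open>join_field N2 G1\<close>, \<open>step3\<close>
    replaces \<open>A\<close> by its conditional expectation; pulling out the
    \<open>G\<close>-measurable factor then does the same for \<open>B\<close>.\<close>
  have "AE \<omega> in M. real_cond_exp M G (indicator (A \<inter> B)) \<omega> =
      real_cond_exp M G (indicator A) \<omega> * real_cond_exp M G (indicator B) \<omega>"
    if AF: "A \<in> sets F" and BH: "B \<in> sets H" for A B
  proof (rule G.real_cond_exp_charact)
    have A: "A \<in> sets (join_field N1 G2)" and B: "B \<in> sets (join_field N2 G1)"
      using AF BH sF sH by auto
    have AM: "A \<in> sets M" and BM: "B \<in> sets M" using A B FM HM by auto
    let ?EA = "real_cond_exp M G (indicator A)"
    let ?EB = "real_cond_exp M G (indicator B)"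
    have EA: "integrable M ?EA" using ind[OF AM] by (rule G.real_cond_exp_int)
    have EAB: "integrable M (\<lambda>x. ?EA x * indicator B x)"
      using ind_mult[OF BM EA] by (simp add: mult_ac)
    show "integrable M (indicator (A \<inter> B) :: _ \<Rightarrow> real)"
      using AM BM by (intro ind) auto
    show "integrable M (\<lambda>x. ?EA x * ?EB x)"
      by (rule G.real_cond_exp_intg(1)[OF EAB]) (use BM in auto)
    show "(\<lambda>x. ?EA x * ?EB x) \<in> borel_measurable G" by measurable
    fix D assume D: "D \<in> sets G"
    have DM: "D \<in> sets M" using D sGM by (auto simp: subalgebra_def)
    have DB: "D \<inter> B \<in> sets (join_field N2 G1)" using D B GH by auto
    have "(LINT x:D|M. indicator (A \<inter> B) x) = (LINT x:D \<inter> B|M. indicator A x :: real)"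
      unfolding set_lebesgue_integral_def
      by (intro Bochner_Integration.integral_cong) (auto simp: indicator_def)
    also have "\<dots> = (LINT x:D \<inter> B|M. ?EA x)" by (rule step3[OF A DB])
    also have "\<dots> = (LINT x|M. (indicator D x * ?EA x) * indicator B x)"
      unfolding set_lebesgue_integral_def
      by (intro Bochner_Integration.integral_cong) (auto simp: indicator_def)
    also have "\<dots> = (LINT x|M. (indicator D x * ?EA x) * ?EB x)"
    proof (rule G.real_cond_exp_intg(2)[symmetric])
      show "integrable M (\<lambda>x. indicator D x * ?EA x * indicator B x)"
        using ind_mult[OF DM EAB] by (simp add: mult_ac)
      show "(\<lambda>x. indicator D x * ?EA x) \<in> borel_measurable G"
        using D by measurable
    qed (use BM in simp)
    also have "\<dots> = (LINT x:D|M. ?EA x * ?EB x)"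
      by (simp add: set_lebesgue_integral_def mult_ac)
    finally show "(LINT x:D|M. indicator (A \<inter> B) x) = (LINT x:D|M. ?EA x * ?EB x)" .
  qed
  moreover have "subalgebra M F" "subalgebra M H"
    using subalgebra_trans[OF FJM F] subalgebra_trans[OF HJM H] .
  ultimately show ?thesis
    using sGM unfolding cond_indep_def by blast
qed

section \<open>Linear differential equations\<close>

text \<open>Picard iteration, written as a series of iterated integrals and differentiated term by
  term. The product is an arbitrary bounded bilinear map so that multiplication by the coefficient
  matrix from the left and from the right are both covered.\<close>

lemma linear_ode_exists:
  fixes prod :: "'b::real_normed_vector \<Rightarrow> 'a::banach \<Rightarrow> 'a"
  assumes prod: "bounded_bilinear prod" and A: "continuous_on {0..1} A"
  shows "\<exists>x. x 0 = v \<and>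
    (\<forall>t\<in>{0..1}. (x has_vector_derivative prod (A t) (x t)) (at t within {0..1::real}))"
proof -
  interpret bounded_bilinear prod by (rule prod)
  obtain K where K: "K \<ge> 0" "\<And>t y. t \<in> {0..1} \<Longrightarrow> norm (prod (A t) y) \<le> K * norm y"
  proof -
    obtain C where C: "C \<ge> 0" "\<And>a b. norm (prod a b) \<le> norm a * norm b * C"
      using nonneg_bounded by blast
    have "compact (A ` {0..1})" using A by (intro compact_continuous_image) auto
    then obtain D where D: "D > 0" "\<And>t. t \<in> {0..1} \<Longrightarrow> norm (A t) \<le> D"
      using compact_imp_bounded[of "A ` {0..1}"] unfolding bounded_pos by auto
    show thesis
    proof (rule that[of "D * C"])
      show "norm (prod (A t) y) \<le> D * C * norm y" if "t \<in> {0..1}" for t y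
      proof -
        have "norm (prod (A t) y) \<le> norm (A t) * norm y * C" by (rule C)
        also have "\<dots> \<le> D * norm y * C"
          using D(2)[OF that] C(1) by (intro mult_right_mono) auto
        finally show ?thesis by (simp add: mult_ac)
      qed
    qed (use C D in auto)
  qed
  \<comment> \<open>\<open>p k\<close> is the part of the solution that is of order \<open>k\<close>
    in \<open>A\<close>; the solution is the sum over all \<open>k\<close>.\<close>
  define p where "p = rec_nat (\<lambda>_. v) (\<lambda>_ q t. integral {0..t} (\<lambda>s. prod (A s) (q s)))"
  have p0: "p 0 = (\<lambda>_. v)" and pS: "p (Suc k) = (\<lambda>t. integral {0..t} (\<lambda>s. prod (A s) (p k s)))" for k
    by (simp_all add: p_def)
  have p_cont: "continuous_on {0..1} (p k)" for k
  proof (induction k)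
    case (Suc k)
    show ?case unfolding pS
      by (intro indefinite_integral_continuous_1 integrable_continuous_interval
          continuous_on[OF A Suc])
  qed (simp add: p0)
  have prod_cont: "continuous_on {0..1} (\<lambda>s. prod (A s) (p k s))" for k
    by (rule continuous_on[OF A p_cont])
  have p_deriv: "(p (Suc k) has_vector_derivative prod (A t) (p k t)) (at t within {0..1})"
    if "t \<in> {0..1}" for k t
    unfolding pS using integral_has_vector_derivative[OF prod_cont that] .
  \<comment> \<open>Integrating the powers of \<open>s\<close> produces the factorial, so the series
    is dominated by an exponential series whatever the size of \<open>K\<close>.\<close>
  have bound: "norm (p k t) \<le> norm v * (K ^ k * t ^ k / fact k)" if "t \<in> {0..1}" for k t
    using that
  proof (induction k arbitrary: t)
    case (Suc k)
    define b where "b = norm v * K ^ Suc k / fact k"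
    have "((\<lambda>s. b * s ^ k) has_integral b * (t ^ Suc k / Suc k) - b * (0 ^ Suc k / Suc k)) {0..t}"
    proof (rule fundamental_theorem_of_calculus)
      fix s :: real
      show "((\<lambda>s. b * (s ^ Suc k / Suc k)) has_vector_derivative b * s ^ k) (at s within {0..t})"
        unfolding has_real_derivative_iff_has_vector_derivative[symmetric]
        by (rule derivative_eq_intros refl | simp)+
    qed (use Suc.prems in auto)
    then have I: "((\<lambda>s. b * s ^ k) has_integral b * (t ^ Suc k / Suc k)) {0..t}" by simp
    have "norm (p (Suc k) t) \<le> integral {0..t} (\<lambda>s. b * s ^ k)"
      unfolding pS
    proof (rule integral_norm_bound_integral)
      show "(\<lambda>s. prod (A s) (p k s)) integrable_on {0..t}"
        using Suc.prems
        by (intro integrable_continuous_interval continuous_on_subset[OF prod_cont]) auto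
      show "(\<lambda>s. b * s ^ k) integrable_on {0..t}" using I by blast
      fix s assume s: "s \<in> {0..t}"
      then have s': "s \<in> {0..1}" using Suc.prems by auto
      have "norm (prod (A s) (p k s)) \<le> K * (norm v * (K ^ k * s ^ k / fact k))"
        using K(2)[OF s'] mult_left_mono[OF Suc.IH[OF s'] K(1)] by (rule order_trans)
      then show "norm (prod (A s) (p k s)) \<le> b * s ^ k"
        by (simp add: b_def mult_ac)
    qed
    also have "\<dots> = b * (t ^ Suc k / Suc k)" using I by blast
    also have "\<dots> = norm v * (K ^ Suc k * t ^ Suc k / fact (Suc k))"
      by (simp add: b_def field_simps)
    finally show ?case .
  qed (simp add: p0)
  have bound': "norm (p k t) \<le> norm v * (K ^ k / fact k)" if t: "t \<in> {0..1}" for k t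
  proof -
    have "norm v * (K ^ k * t ^ k / fact k) \<le> norm v * (K ^ k * 1 / fact k)"
      using t K(1) by (intro mult_left_mono divide_right_mono power_le_one) auto
    then show ?thesis using bound[OF t, of k] by simp
  qed
  have summable: "summable (\<lambda>k. norm v * (K ^ k / fact k))"
    using summable_exp[of K] by (intro summable_mult) (simp add: divide_inverse mult.commute)
  have p_sums: "summable (\<lambda>k. p k t)" if "t \<in> {0..1}" for t
    using summable_comparison_test'[OF summable bound'[OF that]] .
  \<comment> \<open>\<open>d k\<close> is the derivative of \<open>p k\<close>, zero for the
    constant \<open>p 0\<close> and shifted by one index otherwise; \<open>M k\<close> is its
    majorant for the Weierstrass test.\<close>
  define d where "d k t = (case k of 0 \<Rightarrow> 0 | Suc j \<Rightarrow> prod (A t) (p j t))" for k t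
  define M where "M k = (case k of 0 \<Rightarrow> 0 | Suc j \<Rightarrow> K * (norm v * (K ^ j / fact j)))" for k
  have d_bound: "norm (d k t) \<le> M k" if "t \<in> {0..1}" for k t
    using K(2)[OF that] mult_left_mono[OF bound'[OF that] K(1)]
    by (cases k) (auto simp: d_def M_def intro: order_trans)
  have "summable M"
    using summable_mult[OF summable, of K] by (subst summable_Suc_iff[symmetric]) (simp add: M_def)
  then have unif: "uniform_limit {0..1} (\<lambda>n t. \<Sum>k<n. d k t) (\<lambda>t. \<Sum>k. d k t) sequentially"
    using d_bound by (intro Weierstrass_m_test)
  have d_sum: "(\<Sum>k. d k t) = prod (A t) (\<Sum>k. p k t)" if "t \<in> {0..1}" for t
  proof -
    have "(\<lambda>k. prod (A t) (p k t)) sums prod (A t) (\<Sum>k. p k t)"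
      using bounded_linear.sums[OF bounded_linear_right summable_sums[OF p_sums[OF that]]] .
    then have "(\<lambda>k. d (Suc k) t) sums prod (A t) (\<Sum>k. p k t)" by (simp add: d_def)
    then have "(\<lambda>k. d k t) sums (prod (A t) (\<Sum>k. p k t) + d 0 t)" by (rule sums_Suc)
    then show ?thesis by (simp add: d_def sums_unique[symmetric])
  qed
  have "\<exists>g. \<forall>t\<in>{0..1}. (\<lambda>n. p n t) sums g t \<and>
      (g has_derivative (\<lambda>h. h *\<^sub>R (\<Sum>k. d k t))) (at t within {0..1})"
  proof (rule has_derivative_series[where f' = "\<lambda>k t h. h *\<^sub>R d k t"])
    show "(p n has_derivative (\<lambda>h. h *\<^sub>R d n t)) (at t within {0..1})" if "t \<in> {0..1}" for n t
      using p_deriv[OF that] by (cases n) (auto simp: d_def p0 has_vector_derivative_def)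
    show "\<forall>\<^sub>F n in sequentially. \<forall>t\<in>{0..1}. \<forall>h.
        norm ((\<Sum>k<n. h *\<^sub>R d k t) - h *\<^sub>R (\<Sum>k. d k t)) \<le> e * norm h" if "e > 0" for e :: real
      using uniform_limitD[OF unif that]
    proof eventually_elim
      case (elim n)
      show ?case
      proof (intro ballI allI)
        fix t h :: real assume t: "t \<in> {0..1}"
        have "norm ((\<Sum>k<n. h *\<^sub>R d k t) - h *\<^sub>R (\<Sum>k. d k t)) =
            \<bar>h\<bar> * dist (\<Sum>k<n. d k t) (\<Sum>k. d k t)"
          by (simp add: dist_norm scaleR_sum_right[symmetric] scaleR_diff_right[symmetric] del: scaleR_diff_right)
        also have "\<dots> \<le> \<bar>h\<bar> * e" using elim t by (intro mult_left_mono) (auto intro: less_imp_le)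
        finally show "norm ((\<Sum>k<n. h *\<^sub>R d k t) - h *\<^sub>R (\<Sum>k. d k t)) \<le> e * norm h"
          by (simp add: mult.commute)
      qed
    qed
    show "(\<lambda>n. p n 0) sums (\<Sum>n. p n 0)" using p_sums[of 0] by (simp add: summable_sums)
  qed auto
  then obtain g where g: "\<And>t. t \<in> {0..1} \<Longrightarrow> (\<lambda>n. p n t) sums g t"
    "\<And>t. t \<in> {0..1} \<Longrightarrow> (g has_derivative (\<lambda>h. h *\<^sub>R (\<Sum>k. d k t))) (at t within {0..1})"
    by blast
  \<comment> \<open>At time 0 every term but the first is an integral over a single point.\<close>
  have "(\<lambda>n. p n 0) sums (\<Sum>n\<in>{0}. p n 0)"
    by (rule sums_finite) (auto simp: pS gr0_conv_Suc)
  then have "g 0 = v" using sums_unique2[OF g(1)[of 0]] by (simp add: p0)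
  moreover have "(g has_vector_derivative prod (A t) (g t)) (at t within {0..1})" if "t \<in> {0..1}" for t
    using g(2)[OF that] d_sum[OF that] sums_unique[OF g(1)[OF that]]
    by (simp add: has_vector_derivative_def)
  ultimately show ?thesis by blast
qed

lemma bounded_bilinear_matrix_vector_mult:
  "bounded_bilinear ((*v) :: real ^ 'n ^ 'm \<Rightarrow> real ^ 'n \<Rightarrow> real ^ 'm)"
  unfolding bilinear_conv_bounded_bilinear[symmetric] bilinear_def
  by (auto intro!: linearI simp: vec_eq_iff matrix_vector_mult_def sum.distrib sum_distrib_left algebra_simps)

lemma bounded_bilinear_matrix_matrix_mult:
  "bounded_bilinear ((**) :: real ^ 'n ^ 'm \<Rightarrow> real ^ 'k ^ 'n \<Rightarrow> real ^ 'k ^ 'm)"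
  unfolding bilinear_conv_bounded_bilinear[symmetric] bilinear_def
  by (auto intro!: linearI simp: vec_eq_iff matrix_matrix_mult_def sum.distrib sum_distrib_left algebra_simps)

text \<open>\<open>\<Phi>\<close> solves the homogeneous equation and \<open>\<Psi>\<close> its
  adjoint, both starting from the identity. In the derivative of \<open>\<Psi> t ** \<Phi> t\<close>
  the two terms cancel, so the product stays the identity; for square matrices a left inverse is
  also a right inverse.\<close>

lemma fundamental_matrix_exists:
  fixes A :: "real \<Rightarrow> real ^ 'n ^ 'n"
  assumes A: "continuous_on {0..1} A"
  obtains \<Phi> \<Psi> :: "real \<Rightarrow> real ^ 'n ^ 'n" where
    "\<And>t. t \<in> {0..1} \<Longrightarrow> (\<Phi> has_vector_derivative - (A t ** \<Phi> t)) (at t within {0..1})"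
    "\<And>t. t \<in> {0..1} \<Longrightarrow> (\<Psi> has_vector_derivative \<Psi> t ** A t) (at t within {0..1})"
    "\<And>t. t \<in> {0..1} \<Longrightarrow> \<Phi> t ** \<Psi> t = mat 1"
    "\<And>t. t \<in> {0..1} \<Longrightarrow> \<Psi> t ** \<Phi> t = mat 1"
proof -
  note mm = bounded_bilinear_matrix_matrix_mult
  obtain \<Phi> :: "real \<Rightarrow> real ^ 'n ^ 'n" where \<Phi>: "\<Phi> 0 = mat 1"
    "\<And>t. t \<in> {0..1} \<Longrightarrow> (\<Phi> has_vector_derivative (- A t) ** \<Phi> t) (at t within {0..1})"
    using linear_ode_exists[OF mm continuous_on_minus[OF A], of "mat 1"] by blast
  obtain \<Psi> :: "real \<Rightarrow> real ^ 'n ^ 'n" where \<Psi>: "\<Psi> 0 = mat 1"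
    "\<And>t. t \<in> {0..1} \<Longrightarrow> (\<Psi> has_vector_derivative \<Psi> t ** A t) (at t within {0..1})"
    using linear_ode_exists[OF bounded_bilinear.flip[OF mm] A, of "mat 1"] by blast
  have neg: "(- B) ** C = - (B ** C)" for B C :: "real ^ 'n ^ 'n"
    using bounded_bilinear.minus_left[OF mm] .
  have neg': "B ** (- C) = - (B ** C)" for B C :: "real ^ 'n ^ 'n"
    using bounded_bilinear.minus_right[OF mm] .
  have "((\<lambda>t. \<Psi> t ** \<Phi> t) has_vector_derivative 0) (at t within {0..1})" if "t \<in> {0..1}" for t
    using bounded_bilinear.has_vector_derivative[OF mm \<Psi>(2)[OF that] \<Phi>(2)[OF that]]
    by (simp add: neg neg' matrix_mul_assoc)
  then obtain C where C: "\<And>t. t \<in> {0..1} \<Longrightarrow> \<Psi> t ** \<Phi> t = C"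
    using has_vector_derivative_zero_constant[of "{0..1::real}" "\<lambda>t. \<Psi> t ** \<Phi> t"] by auto
  have "C = mat 1" using C[of 0] \<Phi>(1) \<Psi>(1) by simp
  with C have inv: "\<Psi> t ** \<Phi> t = mat 1" if "t \<in> {0..1}" for t using that by simp
  show thesis
    using that[of \<Phi> \<Psi>] \<Phi>(2) \<Psi>(2) inv matrix_left_right_inverse by (simp add: neg) blast
qed

text \<open>
  At least one of the two integrals is over an empty or a one-point interval, so this is the integral
  from \<open>s\<close> to \<open>t\<close> for either order of the endpoints.
\<close>
definition oriented_integral :: "real \<Rightarrow> real \<Rightarrow> (real \<Rightarrow> 'a::banach) \<Rightarrow> 'a" where
  "oriented_integral s t f = integral {s..t} f - integral {t..s} f"

lemma oriented_integral_derivative: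
  fixes F :: "real \<Rightarrow> 'a::banach"
  assumes "\<And>r. r \<in> {0..1} \<Longrightarrow> (F has_vector_derivative f r) (at r within {0..1})"
    and "s \<in> {0..1}" "t \<in> {0..1}"
  shows "oriented_integral s t f = F t - F s"
proof -
  have *: "integral {p..q} f = F q - F p" if "p \<in> {0..1}" "q \<in> {0..1}" "p \<le> q" for p q
    by (intro integral_unique fundamental_theorem_of_calculus that(3))
       (rule has_vector_derivative_within_subset[OF assms(1)], use that in auto)
  have "integral {p..q} f = 0" if "q < p" for p q
    using that by simp
  then show ?thesis
    using *[of s t] *[of t s] assms(2,3) by (cases s t rule: linorder_cases) (auto simp: oriented_integral_def)
qed

text \<open>
  The integration by parts of the stochastic integral of \<open>\<Psi>\<close> with respect to \<open>g\<close>, in terms of the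
  increments \<open>g r - g s\<close> only.
\<close>
definition noise :: "(real \<Rightarrow> real ^ 'n ^ 'n) \<Rightarrow> (real \<Rightarrow> real ^ 'n ^ 'n) \<Rightarrow> (real \<Rightarrow> real ^ 'n ^ 'n)
    \<Rightarrow> (real \<Rightarrow> real ^ 'n) \<Rightarrow> real \<Rightarrow> real \<Rightarrow> real ^ 'n" where
  "noise A \<Phi> \<Psi> g s t =
     g t - g s - \<Phi> t *v oriented_integral s t (\<lambda>r. \<Psi> r *v (A r *v (g r - g s)))"

text \<open>Subtracting \<open>g r - g s\<close> from \<open>y r\<close> leaves a differentiable
  \<open>x\<close> with derivative \<open>- (A r *v y r)\<close>. The derivative of
  \<open>\<Psi> r *v x r\<close> then involves only the increments of \<open>g\<close>, and it is
  integrated from \<open>s\<close>, where \<open>x\<close> and \<open>y\<close> coincide, to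
  \<open>t\<close>.\<close>

lemma variation_of_constants:
  fixes A :: "real \<Rightarrow> real ^ 'n ^ 'n"
  assumes A: "continuous_on {0..1} A"
    and \<Psi>: "\<And>t. t \<in> {0..1} \<Longrightarrow> (\<Psi> has_vector_derivative \<Psi> t ** A t) (at t within {0..1})"
    and inv: "\<And>t. t \<in> {0..1} \<Longrightarrow> \<Phi> t ** \<Psi> t = mat 1"
    and y: "continuous_on {0..1} y"
    and eq: "\<And>t. t \<in> {0..1} \<Longrightarrow> y t - y 0 + integral {0..t} (\<lambda>s. A s *v y s) = g t"
    and st: "s \<in> {0..1}" "t \<in> {0..1}"
  shows "y t = noise A \<Phi> \<Psi> g s t + \<Phi> t *v (\<Psi> s *v y s)"
proof -
  note mv = bounded_bilinear_matrix_vector_mult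
  define x where "x r = y r - (g r - g s)" for r
  have x: "x r = y 0 + g s - integral {0..r} (\<lambda>s. A s *v y s)" if "r \<in> {0..1}" for r
    using eq[OF that] by (simp add: x_def algebra_simps)
  have x': "(x has_vector_derivative - (A r *v y r)) (at r within {0..1})" if "r \<in> {0..1}" for r
  proof -
    have "continuous_on {0..1} (\<lambda>s. A s *v y s)"
      by (rule bounded_bilinear.continuous_on[OF mv A y])
    from integral_has_vector_derivative[OF this that]
    have "((\<lambda>r. y 0 + g s - integral {0..r} (\<lambda>s. A s *v y s)) has_vector_derivative 0 - (A r *v y r))
        (at r within {0..1})"
      by (intro has_vector_derivative_diff has_vector_derivative_const)
    then show ?thesis
      using has_vector_derivative_transform[OF that x] by simp
  qed
  have "((\<lambda>r. - (\<Psi> r *v x r)) has_vector_derivative \<Psi> r *v (A r *v (g r - g s))) (at r within {0..1})"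
    if "r \<in> {0..1}" for r
    using has_vector_derivative_minus[OF bounded_bilinear.has_vector_derivative[OF mv \<Psi>[OF that] x'[OF that]]]
    by (simp add: x_def matrix_vector_mul_assoc[symmetric] matrix_vector_mult_diff_distrib
        bounded_bilinear.minus_right[OF mv])
  from oriented_integral_derivative[OF this st]
  have "oriented_integral s t (\<lambda>r. \<Psi> r *v (A r *v (g r - g s))) = \<Psi> s *v y s - \<Psi> t *v x t"
    by (simp add: x_def)
  then have "\<Phi> t *v oriented_integral s t (\<lambda>r. \<Psi> r *v (A r *v (g r - g s))) =
      \<Phi> t *v (\<Psi> s *v y s) - x t"
    by (simp add: matrix_vector_mult_diff_distrib matrix_vector_mul_assoc[of _ "\<Psi> t"] inv[OF st(2)])
  then show ?thesis by (simp add: noise_def x_def)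
qed

section \<open>Measurability of parameter integrals\<close>

text \<open>Measurability of a parameter integral needs joint measurability of the integrand. This
  holds because the integrand is measurable in \<open>\<omega>\<close> and continuous in
  \<open>r\<close>, hence a pointwise limit of functions that are piecewise constant in
  \<open>r\<close>.\<close>

lemma borel_measurable_integral_param:
  fixes f :: "'a \<Rightarrow> real \<Rightarrow> 'b::euclidean_space"
  assumes cont: "\<And>\<omega>. \<omega> \<in> space N \<Longrightarrow> continuous_on {p..q} (f \<omega>)"
    and meas: "\<And>r. r \<in> {p..q} \<Longrightarrow> (\<lambda>\<omega>. f \<omega> r) \<in> borel_measurable N"
  shows "(\<lambda>\<omega>. integral {p..q} (f \<omega>)) \<in> borel_measurable N"
proof (cases "p \<le> q")
  case False
  then show ?thesis by simp
next
  case True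
  \<comment> \<open>Clamping to \<open>{p..q}\<close> extends each path continuously to the whole
    line, so that rounded times outside the interval do no harm.\<close>
  define cl where "cl r = max p (min q r)" for r
  have cl: "cl r \<in> {p..q}" for r using True by (auto simp: cl_def)
  have cl_id: "cl r = r" if "r \<in> {p..q}" for r using that by (auto simp: cl_def)
  have cl_cont: "continuous_on UNIV cl" unfolding cl_def by (intro continuous_intros)
  \<comment> \<open>The time is rounded down to the grid of mesh \<open>1 / Suc k\<close>. For each
    of the countably many grid values the function depends measurably on \<open>\<omega>\<close>
    alone.\<close>
  have joint: "(\<lambda>x. f (fst x) (cl (snd x))) \<in> borel_measurable (N \<Otimes>\<^sub>M lborel)"
  proof (rule borel_measurable_LIMSEQ_metric)
    fix k :: nat
    show "(\<lambda>x. f (fst x) (cl (real_of_int \<lfloor>real (Suc k) * snd x\<rfloor> / real (Suc k)))) \<in>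
        borel_measurable (N \<Otimes>\<^sub>M lborel)"
    proof (rule measurable_compose_countable[where f = "\<lambda>i x. f (fst x) (cl (real_of_int i / real (Suc k)))"
          and g = "\<lambda>x. \<lfloor>real (Suc k) * snd x\<rfloor>"])
      show "(\<lambda>x. f (fst x) (cl (real_of_int i / real (Suc k)))) \<in> borel_measurable (N \<Otimes>\<^sub>M lborel)"
        for i :: int
        using measurable_compose[OF measurable_fst meas[OF cl]] .
      show "(\<lambda>x. \<lfloor>real (Suc k) * snd x\<rfloor>) \<in> N \<Otimes>\<^sub>M lborel \<rightarrow>\<^sub>M count_space UNIV"
        by measurable
    qed
  next
    fix x :: "'a \<times> real" assume x: "x \<in> space (N \<Otimes>\<^sub>M lborel)"
    then have \<omega>: "fst x \<in> space N" by (auto simp: space_pair_measure)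
    have "(\<lambda>k. real_of_int \<lfloor>real (Suc k) * snd x\<rfloor> / real (Suc k)) \<longlonglongrightarrow> snd x"
    proof (rule tendsto_sandwich[of "\<lambda>k. snd x - 1 / real (Suc k)" _ _ "\<lambda>_. snd x"])
      show "(\<lambda>k. snd x - 1 / real (Suc k)) \<longlonglongrightarrow> snd x"
        using tendsto_diff[OF tendsto_const LIMSEQ_inverse_real_of_nat, of "snd x"]
        by (simp add: inverse_eq_divide)
      show "\<forall>\<^sub>F k in sequentially. snd x - 1 / real (Suc k) \<le>
          real_of_int \<lfloor>real (Suc k) * snd x\<rfloor> / real (Suc k)"
      proof (intro always_eventually allI)
        fix k
        have "real (Suc k) * snd x - 1 \<le> real_of_int \<lfloor>real (Suc k) * snd x\<rfloor>" by linarith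
        then have "(real (Suc k) * snd x - 1) / real (Suc k) \<le>
            real_of_int \<lfloor>real (Suc k) * snd x\<rfloor> / real (Suc k)"
          by (rule divide_right_mono) simp
        then show "snd x - 1 / real (Suc k) \<le> real_of_int \<lfloor>real (Suc k) * snd x\<rfloor> / real (Suc k)"
          by (simp add: diff_divide_distrib)
      qed
      show "\<forall>\<^sub>F k in sequentially. real_of_int \<lfloor>real (Suc k) * snd x\<rfloor> / real (Suc k) \<le> snd x"
      proof (intro always_eventually allI)
        fix k
        have "real_of_int \<lfloor>real (Suc k) * snd x\<rfloor> \<le> snd x * real (Suc k)"
          using of_int_floor_le[of "real (Suc k) * snd x"] by (simp only: mult.commute)
        then show "real_of_int \<lfloor>real (Suc k) * snd x\<rfloor> / real (Suc k) \<le> snd x"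
          by (simp only: pos_divide_le_eq of_nat_0_less_iff zero_less_Suc)
      qed
    qed simp
    moreover have "continuous_on UNIV (\<lambda>r. f (fst x) (cl r))"
      using continuous_on_compose2[OF cont[OF \<omega>] cl_cont] cl by blast
    then have "isCont (\<lambda>r. f (fst x) (cl r)) (snd x)"
      by (simp add: continuous_on_eq_continuous_at)
    ultimately show "(\<lambda>k. f (fst x) (cl (real_of_int \<lfloor>real (Suc k) * snd x\<rfloor> / real (Suc k))))
        \<longlonglongrightarrow> f (fst x) (cl (snd x))"
      by (rule isCont_tendsto_compose[rotated])
  qed
  have "(\<lambda>\<omega>. LINT r|lborel. indicator {p..q} r *\<^sub>R f \<omega> (cl r)) \<in> borel_measurable N"
  proof (rule lborel.borel_measurable_lebesgue_integral)
    show "(\<lambda>(\<omega>, r). indicator {p..q} r *\<^sub>R f \<omega> (cl r)) \<in> borel_measurable (N \<Otimes>\<^sub>M lborel)"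
      unfolding case_prod_beta using joint by measurable
  qed
  moreover have "integral {p..q} (f \<omega>) = (LINT r|lborel. indicator {p..q} r *\<^sub>R f \<omega> (cl r))"
    if "\<omega> \<in> space N" for \<omega>
  proof -
    have "integral {p..q} (f \<omega>) = (LINT r:{p..q}|lborel. f \<omega> r)"
      using set_borel_integral_eq_integral(2)[OF borel_integrable_atLeastAtMost'[OF cont[OF that]]] by simp
    also have "\<dots> = (LINT r|lborel. indicator {p..q} r *\<^sub>R f \<omega> (cl r))"
      unfolding set_lebesgue_integral_def
      by (intro Bochner_Integration.integral_cong) (auto simp: indicator_def cl_id)
    finally show ?thesis .
  qed
  ultimately show ?thesis by (subst measurable_cong) auto
qed

section \<open>Independent increments of the Wiener process\<close>

lemma subalgebra_sigma: "G \<subseteq> sets M \<Longrightarrow> subalgebra M (sigma (space M) G)"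
  unfolding subalgebra_def
  using sets.sigma_sets_subset[of G M] sets.space_closed[of M] by (auto simp: sets_measure_of_conv)

lemma generators_subset_Pow: "generators \<Omega> X I \<subseteq> Pow \<Omega>"
  by (auto simp: generators_def)

lemma generators_subset_sets:
  assumes "\<And>i. i \<in> I \<Longrightarrow> X i \<in> borel_measurable M"
  shows "generators (space M) X I \<subseteq> sets M"
  using measurable_sets[OF assms] by (auto simp: generators_def)

lemma measurable_generators:
  fixes X :: "'i \<Rightarrow> 'a \<Rightarrow> 'b::topological_space"
  assumes "i \<in> I" and G: "generators \<Omega> X I \<subseteq> G" "G \<subseteq> Pow \<Omega>"
  shows "X i \<in> borel_measurable (sigma \<Omega> G)"
proof (rule measurableI)
  fix S :: "'b set" assume "S \<in> sets borel"
  with \<open>i \<in> I\<close> have "X i -` S \<inter> \<Omega> \<in> generators \<Omega> X I" by (auto simp: generators_def)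
  then show "X i -` S \<inter> space (sigma \<Omega> G) \<in> sets (sigma \<Omega> G)"
    using G by (simp add: space_measure_of_conv sets_measure_of sigma_sets.Basic subset_iff)
qed simp

text \<open>The sigma-fields of finite subfamilies are directed, so their union is an Int-stable
  generator and independence need be checked for finitely many indices only. A single finite
  \<open>F\<close> serves both sides, which permits a common time grid.\<close>

lemma (in prob_space) indep_set_generators:
  fixes X :: "'i \<Rightarrow> 'a \<Rightarrow> 'b::topological_space"
  assumes fin: "\<And>F. finite F \<Longrightarrow> F \<subseteq> I \<union> J \<Longrightarrow>
    indep_set (sigma_sets (space M) (generators (space M) X (F \<inter> I)))
      (sigma_sets (space M) (generators (space M) X (F \<inter> J)))"
  shows "indep_set (sigma_sets (space M) (generators (space M) X I))
    (sigma_sets (space M) (generators (space M) X J))"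
proof -
  define E where "E K = (\<Union>F\<in>{F. finite F \<and> F \<subseteq> K}. sigma_sets (space M) (generators (space M) X F))" for K
  have mono: "sigma_sets (space M) (generators (space M) X F) \<subseteq> sigma_sets (space M) (generators (space M) X F')"
    if "F \<subseteq> F'" for F F' :: "'i set"
    using that by (intro sigma_sets_mono') (auto simp: generators_def)
  have stable: "Int_stable (E K)" for K
  proof (rule Int_stableI)
    fix A B assume "A \<in> E K" "B \<in> E K"
    then obtain F F' where F: "finite F" "F \<subseteq> K" "A \<in> sigma_sets (space M) (generators (space M) X F)"
      and F': "finite F'" "F' \<subseteq> K" "B \<in> sigma_sets (space M) (generators (space M) X F')"
      by (auto simp: E_def)
    interpret sigma_algebra "space M" "sigma_sets (space M) (generators (space M) X (F \<union> F'))"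
      by (rule sigma_algebra_sigma_sets[OF generators_subset_Pow])
    have "A \<inter> B \<in> sigma_sets (space M) (generators (space M) X (F \<union> F'))"
      using F(3) F'(3) mono[of F "F \<union> F'"] mono[of F' "F \<union> F'"] by (intro Int) auto
    then show "A \<inter> B \<in> E K" using F F' unfolding E_def by blast
  qed
  have "indep_set (E I) (E J)"
    unfolding indep_sets2_eq
  proof (intro conjI ballI)
    have "sigma_sets (space M) (generators (space M) X F) \<subseteq> events" if "finite F" "F \<subseteq> I" for F
      using indep_setD_ev1[OF fin[of F]] that by (simp add: Int_absorb2 le_supI1)
    then show "E I \<subseteq> events" unfolding E_def by blast
    have "sigma_sets (space M) (generators (space M) X F) \<subseteq> events" if "finite F" "F \<subseteq> J" for F
      using indep_setD_ev2[OF fin[of F]] that by (simp add: Int_absorb2 le_supI2)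
    then show "E J \<subseteq> events" unfolding E_def by blast
    fix A B assume "A \<in> E I" "B \<in> E J"
    then obtain F F' where F: "finite F" "F \<subseteq> I" "A \<in> sigma_sets (space M) (generators (space M) X F)"
      and F': "finite F'" "F' \<subseteq> J" "B \<in> sigma_sets (space M) (generators (space M) X F')"
      by (auto simp: E_def)
    have "A \<in> sigma_sets (space M) (generators (space M) X ((F \<union> F') \<inter> I))"
      "B \<in> sigma_sets (space M) (generators (space M) X ((F \<union> F') \<inter> J))"
      using F F' mono[of F "(F \<union> F') \<inter> I"] mono[of F' "(F \<union> F') \<inter> J"] by blast+
    moreover have "finite (F \<union> F')" "F \<union> F' \<subseteq> I \<union> J" using F F' by auto
    ultimately show "prob (A \<inter> B) = prob A * prob B" using indep_setD[OF fin] by blast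
  qed
  then have ind: "indep_set (sigma_sets (space M) (E I)) (sigma_sets (space M) (E J))"
    by (rule indep_set_sigma_sets) (rule stable)+
  have "generators (space M) X K \<subseteq> E K" for K
  proof
    fix A assume "A \<in> generators (space M) X K"
    then obtain i where "i \<in> K" "A \<in> generators (space M) X {i}"
      by (auto simp: generators_def)
    then show "A \<in> E K" unfolding E_def by (intro UN_I[of "{i}"]) (auto intro: sigma_sets.Basic)
  qed
  then show ?thesis
    by (intro indep_set_mono[OF ind] sigma_sets_mono')
qed

text \<open>
  Increments outside \<open>[a,b]\<close> are measured from the endpoint that does not cross the interval.
\<close>
definition anchor :: "real \<Rightarrow> real \<Rightarrow> real \<Rightarrow> real" where
  "anchor a b r = (if r \<le> b then a else b)"

text \<open>For finitely many times, every anchored increment is a signed sum of consecutive grid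
  increments, all of them inside \<open>[a,b]\<close> or all of them outside. The two groups use
  disjoint sets of independent increments.\<close>

lemma wiener_increments_indep:
  assumes W: "standard_wiener_process M W" and ab: "0 \<le> a" "a < b" "b \<le> 1"
  defines "X \<equiv> \<lambda>r \<omega>. W r \<omega> - W (anchor a b r) \<omega>"
  shows "prob_space.indep_set M
    (sigma_sets (space M) (generators (space M) X {a..b}))
    (sigma_sets (space M) (generators (space M) X ({0..1} - {a..b})))"
proof -
  interpret prob_space M using W by (simp add: standard_wiener_process_def)
  show ?thesis
  proof (rule indep_set_generators)
    fix F assume F: "finite F" "F \<subseteq> {a..b} \<union> ({0..1} - {a..b})"
    \<comment> \<open>With \<open>a\<close> and \<open>b\<close> among the grid points no grid step
      straddles an endpoint.\<close>
    have "finite (F \<union> {a, b})" using F by simp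
    then have "\<exists>xs. set xs = F \<union> {a, b} \<and> sorted xs \<and> distinct xs"
      by (rule finite_sorted_distinct_unique[THEN ex1_implies_ex])
    then obtain xs where xs: "set xs = F \<union> {a, b}" "sorted xs" "distinct xs"
      by (elim exE conjE)
    define k where "k = length xs - 1"
    define \<tau> where "\<tau> i = xs ! i" for i
    have len: "length xs = Suc k"
    proof -
      have "a \<in> set xs" unfolding xs(1) by blast
      then show ?thesis unfolding k_def using length_pos_if_in_set[of a xs] by simp
    qed
    have \<tau>_mono: "\<tau> i \<le> \<tau> j" if "i \<le> j" "j \<le> k" for i j
      using that len unfolding \<tau>_def by (intro sorted_nth_mono xs) auto
    have \<tau>_neq: "\<tau> i \<noteq> \<tau> j" if "i < j" "j \<le> k" for i j
      using that len nth_eq_iff_index_eq[OF xs(3), of i j] by (simp add: \<tau>_def)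
    have \<tau>_inv: "\<exists>i\<le>k. r = \<tau> i" if "r \<in> F \<union> {a, b}" for r
    proof -
      have "r \<in> set xs" using that xs(1) by simp
      then obtain i where "i < length xs" "r = xs ! i" by (auto simp: in_set_conv_nth)
      then show ?thesis using len by (intro exI[of _ i]) (simp add: \<tau>_def)
    qed
    have "\<tau> ` {..k} \<subseteq> set xs" using len by (auto simp: \<tau>_def)
    also have "\<dots> \<subseteq> {0..1}" using F ab xs(1) by auto
    finally have \<tau>_ran: "\<tau> ` {..k} \<subseteq> {0..1}" .
    define \<Delta> where "\<Delta> i \<omega> = W (\<tau> (Suc i)) \<omega> - W (\<tau> i) \<omega>" for i \<omega>
    have "mono_on {..k} \<tau>" using \<tau>_mono by (auto intro!: mono_onI)
    then have ind: "indep_vars (\<lambda>_. borel) \<Delta> {..<k}"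
      using W \<tau>_ran unfolding standard_wiener_process_def \<Delta>_def by blast
    \<comment> \<open>The index \<open>i\<close> stands for the step from \<open>\<tau> i\<close> to
      \<open>\<tau> (Suc i)\<close>. \<open>A\<close> collects the inner steps and \<open>B\<close>
      the outer ones; they are disjoint because every step has positive length.\<close>
    define A where "A = {i\<in>{..<k}. a \<le> \<tau> i \<and> \<tau> (Suc i) \<le> b}"
    define B where "B = {i\<in>{..<k}. \<tau> (Suc i) \<le> a \<or> b \<le> \<tau> i}"
    have "A \<inter> B = {}"
    proof -
      have "\<tau> i < \<tau> (Suc i)" if "i < k" for i
        using \<tau>_mono[of i "Suc i"] \<tau>_neq[of i "Suc i"] that by auto
      then show ?thesis by (fastforce simp: A_def B_def)
    qed
    then have "indep_var (PiM A (\<lambda>_. borel)) (\<lambda>\<omega>. restrict (\<lambda>i. \<Delta> i \<omega>) A)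
        (PiM B (\<lambda>_. borel)) (\<lambda>\<omega>. restrict (\<lambda>i. \<Delta> i \<omega>) B)"
      by (rule indep_var_restrict[OF ind]) (auto simp: A_def B_def)
    then have indS: "indep_set
        (sigma_sets (space M) {(\<lambda>\<omega>. restrict (\<lambda>i. \<Delta> i \<omega>) A) -` S \<inter> space M | S. S \<in> sets (PiM A (\<lambda>_. borel))})
        (sigma_sets (space M) {(\<lambda>\<omega>. restrict (\<lambda>i. \<Delta> i \<omega>) B) -` S \<inter> space M | S. S \<in> sets (PiM B (\<lambda>_. borel))})"
      unfolding indep_var_eq by blast
    have tel: "W (\<tau> j) \<omega> - W (\<tau> i) \<omega> = (\<Sum>l\<in>{i..<j}. \<Delta> l \<omega>)" if "i \<le> j" for i j \<omega>
      using sum_Suc_diff'[OF that, of "\<lambda>l. W (\<tau> l) \<omega>"] by (simp add: \<Delta>_def)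
    \<comment> \<open>Each \<open>X r\<close> factors measurably through the vector of increments
      with indices in \<open>D\<close>. The constant \<open>c\<close> carries the sign of the
      increment.\<close>
    have sub: "generators (space M) X K \<subseteq>
        {(\<lambda>\<omega>. restrict (\<lambda>i. \<Delta> i \<omega>) D) -` S \<inter> space M | S. S \<in> sets (PiM D (\<lambda>_. borel))}"
      if *: "\<And>r. r \<in> K \<Longrightarrow> \<exists>L c. L \<subseteq> D \<and> (\<forall>\<omega>. X r \<omega> = c * (\<Sum>l\<in>L. \<Delta> l \<omega>))" for K D
    proof
      fix Z assume "Z \<in> generators (space M) X K"
      then obtain r S where r: "r \<in> K" and S: "S \<in> sets borel" and Z: "Z = X r -` S \<inter> space M"
        by (auto simp: generators_def)
      obtain L c where L: "L \<subseteq> D" "\<And>\<omega>. X r \<omega> = c * (\<Sum>l\<in>L. \<Delta> l \<omega>)" using *[OF r] by blast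
      define h :: "(nat \<Rightarrow> real) \<Rightarrow> real" where "h v = c * (\<Sum>l\<in>L. v l)" for v
      have "h \<in> borel_measurable (PiM D (\<lambda>_. borel))"
        unfolding h_def using L(1) by (intro borel_measurable_times borel_measurable_sum
            borel_measurable_const measurable_component_singleton) auto
      then have "h -` S \<inter> space (PiM D (\<lambda>_. borel)) \<in> sets (PiM D (\<lambda>_. borel))"
        using S by (rule measurable_sets)
      moreover have "X r \<omega> = h (restrict (\<lambda>i. \<Delta> i \<omega>) D)" for \<omega>
        unfolding L(2) h_def using L(1) by (intro arg_cong2[of _ _ _ _ "(*)"] sum.cong) auto
      then have "Z = (\<lambda>\<omega>. restrict (\<lambda>i. \<Delta> i \<omega>) D) -` (h -` S \<inter> space (PiM D (\<lambda>_. borel))) \<inter> space M"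
        unfolding Z by (auto simp: space_PiM)
      ultimately show "Z \<in> {(\<lambda>\<omega>. restrict (\<lambda>i. \<Delta> i \<omega>) D) -` S \<inter> space M | S. S \<in> sets (PiM D (\<lambda>_. borel))}"
        by blast
    qed
    obtain ia ib where ia: "ia \<le> k" "a = \<tau> ia" and ib: "ib \<le> k" "b = \<tau> ib"
      using \<tau>_inv[of a] \<tau>_inv[of b] by auto
    have \<tau>_le: "i \<le> j" if "\<tau> i < \<tau> j" "i \<le> k" "j \<le> k" for i j
      using that \<tau>_mono[of j i] by linarith
    show "indep_set (sigma_sets (space M) (generators (space M) X (F \<inter> {a..b})))
        (sigma_sets (space M) (generators (space M) X (F \<inter> ({0..1} - {a..b}))))"
    proof (rule indep_set_mono[OF indS]; intro sigma_sets_mono' sub)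
      fix r assume r: "r \<in> F \<inter> {a..b}"
      then obtain q where q: "q \<le> k" "r = \<tau> q" using \<tau>_inv[of r] by auto
      show "\<exists>L c. L \<subseteq> A \<and> (\<forall>\<omega>. X r \<omega> = c * (\<Sum>l\<in>L. \<Delta> l \<omega>))"
      \<comment> \<open>Indices can be compared by \<open>\<tau>_le\<close> only for strictly
        ordered times; at \<open>r = a\<close> the increment is the empty sum.\<close>
      proof (cases "r = a")
        case True
        then show ?thesis using ab by (intro exI[of _ "{}"]) (simp add: X_def anchor_def)
      next
        case False
        then have "ia \<le> q" using \<tau>_le[of ia q] r q ia by auto
        moreover have "{ia..<q} \<subseteq> A"
        proof
          fix l assume "l \<in> {ia..<q}"
          then show "l \<in> A"
            using \<tau>_mono[of ia l] \<tau>_mono[of "Suc l" q] q r ia by (auto simp: A_def)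
        qed
        ultimately show ?thesis
          using r q ia tel[of ia q] by (intro exI[of _ "{ia..<q}"] exI[of _ 1]) (auto simp: X_def anchor_def)
      qed
    next
      fix r assume r: "r \<in> F \<inter> ({0..1} - {a..b})"
      then obtain q where q: "q \<le> k" "r = \<tau> q" using \<tau>_inv[of r] by auto
      show "\<exists>L c. L \<subseteq> B \<and> (\<forall>\<omega>. X r \<omega> = c * (\<Sum>l\<in>L. \<Delta> l \<omega>))"
      proof (cases "r < a")
        case True
        then have le: "q \<le> ia" using \<tau>_le[of q ia] q ia by auto
        have "{q..<ia} \<subseteq> B"
        proof
          fix l assume "l \<in> {q..<ia}"
          then show "l \<in> B" using \<tau>_mono[of "Suc l" ia] ia by (auto simp: B_def)
        qed
        \<comment> \<open>To the left of \<open>a\<close> the increment runs backwards from its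
          anchor.\<close>
        moreover have "X r \<omega> = (- 1) * (\<Sum>l\<in>{q..<ia}. \<Delta> l \<omega>)" for \<omega>
          using tel[OF le, of \<omega>] True ab q ia by (simp add: X_def anchor_def)
        ultimately show ?thesis by blast
      next
        case False
        then have "b < r" using r by auto
        then have le: "ib \<le> q" using \<tau>_le[of ib q] q ib by auto
        have "{ib..<q} \<subseteq> B"
        proof
          fix l assume "l \<in> {ib..<q}"
          then show "l \<in> B" using \<tau>_mono[of ib l] ib q by (auto simp: B_def)
        qed
        moreover have "X r \<omega> = 1 * (\<Sum>l\<in>{ib..<q}. \<Delta> l \<omega>)" for \<omega>
          using tel[OF le, of \<omega>] \<open>b < r\<close> q ib by (simp add: X_def anchor_def)
        ultimately show ?thesis by blast
      qed
    qed
  qed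
qed

section \<open>The boundary value problem\<close>

lemma borel_measurable_matrix_vector_mult:
  fixes C :: "real ^ 'n ^ 'm"
  assumes "f \<in> borel_measurable M"
  shows "(\<lambda>\<omega>. C *v f \<omega>) \<in> borel_measurable M"
  using measurable_compose[OF assms borel_measurable_continuous_onI[OF matrix_vector_mult_linear_continuous_on[of UNIV C]]] .

text \<open>The noise is measurable for any field that contains the increments between
  \<open>s\<close> and \<open>t\<close>; this is what separates inner from outer noise.\<close>

lemma borel_measurable_noise:
  fixes g :: "'a \<Rightarrow> real \<Rightarrow> real ^ 'n"
  assumes A: "continuous_on {0..1} A" and \<Psi>: "continuous_on {0..1} \<Psi>"
    and st: "s \<in> {0..1}" "t \<in> {0..1}"
    and cont: "\<And>\<omega>. \<omega> \<in> space N \<Longrightarrow> continuous_on {0..1} (g \<omega>)"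
    and meas: "\<And>r. r \<in> {min s t..max s t} \<Longrightarrow> (\<lambda>\<omega>. g \<omega> r - g \<omega> s) \<in> borel_measurable N"
  shows "(\<lambda>\<omega>. noise A \<Phi> \<Psi> (g \<omega>) s t) \<in> borel_measurable N"
proof -
  note mv = bounded_bilinear_matrix_vector_mult
  have int: "(\<lambda>\<omega>. integral {p..q} (\<lambda>r. \<Psi> r *v (A r *v (g \<omega> r - g \<omega> s)))) \<in> borel_measurable N"
    if pq: "{p..q} \<subseteq> {min s t..max s t}" for p q
  proof (rule borel_measurable_integral_param)
    have sub: "{p..q} \<subseteq> {0..1}" using pq st by (auto simp: min_def max_def split: if_splits)
    show "continuous_on {p..q} (\<lambda>r. \<Psi> r *v (A r *v (g \<omega> r - g \<omega> s)))" if "\<omega> \<in> space N" for \<omega>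
      using continuous_on_subset[OF A sub] continuous_on_subset[OF \<Psi> sub] continuous_on_subset[OF cont[OF that] sub]
      by (intro bounded_bilinear.continuous_on[OF mv] continuous_on_diff continuous_on_const) auto
    show "(\<lambda>\<omega>. \<Psi> r *v (A r *v (g \<omega> r - g \<omega> s))) \<in> borel_measurable N" if "r \<in> {p..q}" for r
      using meas pq that by (intro borel_measurable_matrix_vector_mult) auto
  qed
  show ?thesis
    unfolding noise_def oriented_integral_def
    by (intro borel_measurable_diff[OF meas] borel_measurable_diff borel_measurable_matrix_vector_mult int) auto
qed

text \<open>Turns well-posedness into the injectivity of the boundary operator on initial
  states.\<close>

lemma homogeneous_solution:
  fixes A :: "real \<Rightarrow> real ^ 'n ^ 'n"
  assumes A: "continuous_on {0..1} A"
    and \<Phi>: "\<And>t. t \<in> {0..1} \<Longrightarrow> (\<Phi> has_vector_derivative - (A t ** \<Phi> t)) (at t within {0..1})"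
    and bc: "\<Lambda> (\<lambda>t. \<Phi> t *v v) = 0"
  shows "bvp_solution A (\<lambda>_. 0) \<Lambda> 0 (\<lambda>t. \<Phi> t *v v)"
  unfolding bvp_solution_def
proof (intro conjI ballI)
  note mv = bounded_bilinear_matrix_vector_mult
  have D: "((\<lambda>t. \<Phi> t *v v) has_vector_derivative - (A t *v (\<Phi> t *v v))) (at t within {0..1})"
    if "t \<in> {0..1}" for t
    using bounded_bilinear.has_vector_derivative[OF mv \<Phi>[OF that] has_vector_derivative_const[of v]]
    by (simp add: matrix_vector_mul_assoc bounded_bilinear.minus_left[OF mv])
  then show "continuous_on {0..1} (\<lambda>t. \<Phi> t *v v)"
    by (intro continuous_on_vector_derivative) auto
  fix t :: real assume t: "t \<in> {0..1}"
  have "((\<lambda>s. - (A s *v (\<Phi> s *v v))) has_integral \<Phi> t *v v - \<Phi> 0 *v v) {0..t}"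
    using t by (intro fundamental_theorem_of_calculus has_vector_derivative_within_subset[OF D]) auto
  from has_integral_neg[OF this] show "\<Phi> t *v v - \<Phi> 0 *v v + integral {0..t} (\<lambda>s. A s *v (\<Phi> s *v v)) = 0"
    by (auto dest: integral_unique)
qed (rule bc)

lemma continuous_on_companion_matrix:
  assumes "\<And>k. k < CARD('n::{finite,linorder}) \<Longrightarrow> continuous_on S (coef k)"
  shows "continuous_on S (companion_matrix coef :: real \<Rightarrow> real ^ 'n::{finite,linorder} ^ 'n::{finite,linorder})"
proof -
  \<comment> \<open>Numbering from 1 makes \<open>CARD('n) - pos j\<close> less than
    \<open>CARD('n)\<close>, so only coefficients known to be continuous occur in the first
    row.\<close>
  have "pos j > 0" for j :: 'n
    using card_gt_0_iff[of "{..j}"] by (auto simp: pos_def)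
  then have "continuous_on S (\<lambda>s. if pos i = 1 then coef (CARD('n) - pos j) s
      else if pos i = pos j + 1 then - 1 else 0)" for i j :: 'n
    using assms[of "CARD('n) - pos j"] by (cases "pos i = 1") (simp_all add: diff_less less_not_refl2)
  then show ?thesis
    unfolding companion_matrix_def by (intro continuous_on_vec_lambda)
qed

lemma continuous_on_wiener_space:
  assumes "wiener_measure P" "\<omega> \<in> space P"
  shows "continuous_on {0..1} \<omega>"
proof -
  have "\<omega> \<in> mspace (cfunspace (top_of_set {0..1}) euclidean_metric)"
    using assms by (simp add: wiener_measure_def C0_metric_def)
  then show ?thesis by (simp add: continuous_map_iff_continuous mtopology_of_euclidean)
qed

lemma last_comp_add: "last_comp (x + y) = last_comp x + last_comp y"
  by (simp add: last_comp_def)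

lemma borel_measurable_last_comp:
  fixes f :: "'a \<Rightarrow> real ^ 'n::{finite,linorder}"
  assumes "f \<in> borel_measurable M"
  shows "(\<lambda>\<omega>. last_comp (f \<omega>)) \<in> borel_measurable M"
  unfolding last_comp_def
  by (rule measurable_compose[OF assms]) (intro borel_measurable_continuous_onI continuous_intros)

lemma borel_measurable_vec_lambda:
  fixes f :: "'i::finite \<Rightarrow> 'a \<Rightarrow> real"
  assumes "\<And>i. f i \<in> borel_measurable M"
  shows "(\<lambda>\<omega>. \<chi> i. f i \<omega>) \<in> borel_measurable M"
proof -
  have "(\<chi> i. f i \<omega>) = (\<Sum>i\<in>UNIV. f i \<omega> *\<^sub>R axis i 1)" for \<omega>
    using basis_expansion[of "\<chi> i. f i \<omega>"] by (simp add: scalar_mult_eq_scaleR)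
  then show ?thesis using assms by simp
qed

text \<open>Treats both choices of the conditioning field at once: \<open>T\<close> is the set of
  observed times, and \<open>split\<close> says that for each boundary condition the times on at
  least one side of the interval are observed.\<close>

lemma cond_indep_splitting:
  fixes P :: "(real \<Rightarrow> real) measure"
    and \<alpha> :: "real ^ 'm::finite ^ 'n::{finite,linorder}"
    and A :: "real \<Rightarrow> real ^ 'n::{finite,linorder} ^ 'n::{finite,linorder}"
  assumes wiener: "wiener_measure P"
    and A: "continuous_on {0..1} A"
    and times: "\<And>j. t j \<in> {0..1}"
    and well_posed: "well_posed A (boundary_op \<alpha> t)"
    and solution: "\<And>\<omega>. \<omega> \<in> space P \<Longrightarrow>
      bvp_solution A (forcing \<omega>) (boundary_op \<alpha> t) c (\<lambda>s. Y s \<omega>)"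
    and ab: "0 \<le> a" "a < b" "b \<le> 1"
    and ab_supp: "a \<notin> (\<Union>i. supp \<alpha> t i)" "b \<notin> (\<Union>i. supp \<alpha> t i)"
    and T: "T \<subseteq> {0..1}"
    and split: "\<And>i. supp \<alpha> t i \<inter> {a<..<b} \<subseteq> T \<or> supp \<alpha> t i \<inter> ({0..1} - {a..b}) \<subseteq> T"
  shows "cond_indep P (boundary_field (space P) Y a b T)
    (sigma (space P) (generators (space P) Y {a..b}))
    (sigma (space P) (generators (space P) Y ({0..1} - {a<..<b})))"
proof -

  \<comment> \<open>Fundamental matrices and the fields of inner and outer increments\<close>
  have W: "standard_wiener_process P (\<lambda>r \<omega>. \<omega> r)" using wiener by (simp add: wiener_measure_def)
  interpret prob_space P using W by (simp add: standard_wiener_process_def)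
  obtain \<Phi> \<Psi> :: "real \<Rightarrow> real ^ 'n::{finite,linorder} ^ 'n::{finite,linorder}" where
    \<Phi>: "\<And>t. t \<in> {0..1} \<Longrightarrow> (\<Phi> has_vector_derivative - (A t ** \<Phi> t)) (at t within {0..1})"
    and \<Psi>: "\<And>t. t \<in> {0..1} \<Longrightarrow> (\<Psi> has_vector_derivative \<Psi> t ** A t) (at t within {0..1})"
    and \<Phi>\<Psi>: "\<And>t. t \<in> {0..1} \<Longrightarrow> \<Phi> t ** \<Psi> t = mat 1"
    and \<Psi>\<Phi>: "\<And>t. t \<in> {0..1} \<Longrightarrow> \<Psi> t ** \<Phi> t = mat 1"
    using fundamental_matrix_exists[OF A] by metis
  have \<Psi>_cont: "continuous_on {0..1} \<Psi>"
    using \<Psi> by (intro continuous_on_vector_derivative) auto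
  have a01: "a \<in> {0..1}" and b01: "b \<in> {0..1}" using ab by auto
  define s where "s = anchor a b"
  have s01: "s r \<in> {0..1}" and s_cases: "s r = a \<or> s r = b" for r
    using a01 b01 by (auto simp: s_def anchor_def)
  have s_le: "s r = a" if "r \<le> b" for r using that by (simp add: s_def anchor_def)
  have s_gt: "s r = b" if "b < r" for r using that by (simp add: s_def anchor_def)
  define X where "X r = (\<lambda>\<omega> :: real \<Rightarrow> real. \<omega> r - \<omega> (s r))" for r
  define N1 where "N1 = sigma (space P) (generators (space P) X {a..b})"
  define N2 where "N2 = sigma (space P) (generators (space P) X ({0..1} - {a..b}))"
  have spN: "space N1 = space P" "space N2 = space P"
    by (simp_all add: N1_def N2_def space_measure_of_conv)
  have X_P: "X r \<in> borel_measurable P" if "r \<in> {0..1}" for r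
    using W that s01[of r] unfolding standard_wiener_process_def X_def
    by (intro borel_measurable_diff) auto
  have subN: "subalgebra P N1" "subalgebra P N2"
    unfolding N1_def N2_def using X_P ab
    by (auto intro!: subalgebra_sigma generators_subset_sets)
  have indep: "indep_set (sets N1) (sets N2)"
    using wiener_increments_indep[OF W ab]
    unfolding N1_def N2_def X_def s_def by (simp add: sets_measure_of generators_subset_Pow)
  have X_N1: "X r \<in> borel_measurable N1" if "r \<in> {a..b}" for r
    unfolding N1_def using that by (intro measurable_generators[OF _ order_refl generators_subset_Pow])
  have X_N2: "X r \<in> borel_measurable N2" if "r \<in> {0..1} - {a..b}" for r
    unfolding N2_def using that by (intro measurable_generators[OF _ order_refl generators_subset_Pow])

  \<comment> \<open>Noise terms and their measurability\<close>
  define Z where "Z r = (\<lambda>\<omega>. noise A \<Phi> \<Psi> (forcing \<omega>) (s r) r)" for r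
  \<comment> \<open>\<open>forcing (\<lambda>_. 1) 0\<close> is the first unit vector, so vector
    increments reduce to scalar increments of the Wiener path.\<close>
  have forcing_diff: "forcing \<omega> r - forcing \<omega> r' = (\<omega> r - \<omega> r') *\<^sub>R forcing (\<lambda>_. 1) 0" for \<omega> r r'
    by (simp add: forcing_def vec_eq_iff)
  have forcing_cont: "continuous_on {0..1} (forcing \<omega> :: real \<Rightarrow> real ^ 'n::{finite,linorder})" if "\<omega> \<in> space P" for \<omega>
  proof -
    have "continuous_on {0..1} (\<lambda>r. if pos i = 1 then \<omega> r else 0)" for i :: 'n
      using continuous_on_wiener_space[OF wiener that] by (cases "pos i = 1") auto
    then show ?thesis unfolding forcing_def by (intro continuous_on_vec_lambda)
  qed
  have Z_meas: "Z r \<in> borel_measurable N"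
    if N: "space N = space P" and r: "r \<in> {0..1}"
      and meas: "\<And>r'. r' \<in> {min (s r) r..max (s r) r} \<Longrightarrow> (\<lambda>\<omega>. \<omega> r' - \<omega> (s r)) \<in> borel_measurable N" for N r
    unfolding Z_def
  proof (rule borel_measurable_noise[OF A \<Psi>_cont s01 r])
    show "(\<lambda>\<omega>. forcing \<omega> r' - forcing \<omega> (s r)) \<in> borel_measurable N"
      if "r' \<in> {min (s r) r..max (s r) r}" for r'
      unfolding forcing_diff by (intro borel_measurable_scaleR meas[OF that] borel_measurable_const)
  qed (use forcing_cont N in auto)
  have Z_N1: "Z r \<in> borel_measurable N1" if r: "r \<in> {a..b}" for r
  proof (rule Z_meas[OF spN(1)])
    fix r' assume "r' \<in> {min (s r) r..max (s r) r}"
    then have r': "r' \<in> {a..b}" using s_le[of r] r by auto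
    then show "(\<lambda>\<omega>. \<omega> r' - \<omega> (s r)) \<in> borel_measurable N1"
      using X_N1[OF r'] s_le[of r] s_le[of r'] r by (simp add: X_def cong: measurable_cong)
  qed (use r ab in auto)
  have Z_N2: "Z r \<in> borel_measurable N2" if r: "r \<in> {0..1} - {a..b}" for r
  proof (rule Z_meas[OF spN(2)])
    fix r' assume r': "r' \<in> {min (s r) r..max (s r) r}"
    show "(\<lambda>\<omega>. \<omega> r' - \<omega> (s r)) \<in> borel_measurable N2"
    \<comment> \<open>The anchor itself is not an outer time, but the increment there is zero; all
      other points between the anchor and \<open>r\<close> are outer times with the same
      anchor.\<close>
    proof (cases "r' = s r")
      case False
      have "r' \<in> {0..1} - {a..b} \<and> s r' = s r"
      proof (cases "r < a")
        case True
        then show ?thesis using r r' False ab s_le[of r] s_le[of r'] by auto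
      next
        case F: False
        then show ?thesis using r r' False ab s_gt[of r] s_gt[of r'] by auto
      qed
      then show ?thesis using X_N2[of r'] unfolding X_def by auto
    qed simp
  qed (use r in auto)

  \<comment> \<open>Decomposition of the boundary condition\<close>
  have Y: "Y r \<omega> = Z r \<omega> + \<Phi> r *v (\<Psi> (s r) *v Y (s r) \<omega>)" if "\<omega> \<in> space P" "r \<in> {0..1}" for r \<omega>
    unfolding Z_def using solution[OF that(1)] unfolding bvp_solution_def
    by (intro variation_of_constants[OF A \<Psi> \<Phi>\<Psi>]) (use s01 that in auto)
  define V where "V r = (\<lambda>\<omega>. last_comp (Z r \<omega>))" for r
  \<comment> \<open>\<open>V\<close> is the noise in the last component, and \<open>D\<close> is the
    part determined by the state at the anchor.\<close>
  define D where "D r = (\<lambda>\<omega>. last_comp (\<Phi> r *v (\<Psi> (s r) *v Y (s r) \<omega>)))" for r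
  have lastY: "last_comp (Y r \<omega>) = V r \<omega> + D r \<omega>" if "\<omega> \<in> space P" "r \<in> {0..1}" for r \<omega>
    unfolding V_def D_def last_comp_add[symmetric] using Y[OF that] by simp
  define In where "In i = (\<lambda>\<omega>. (\<Sum>j | t j \<in> {a..b}. \<alpha> $ i $ j * V (t j) \<omega>))" for i
  define Out where "Out i = (\<lambda>\<omega>. (\<Sum>j | t j \<notin> {a..b}. \<alpha> $ i $ j * V (t j) \<omega>))" for i
  \<comment> \<open>The boundary condition fixes the sum of both parts once \<open>Y a\<close> and \<open>Y b\<close> are known.\<close>
  have In_Out: "In i \<omega> + Out i \<omega> = c $ i - (\<Sum>j\<in>UNIV. \<alpha> $ i $ j * D (t j) \<omega>)" if "\<omega> \<in> space P" for i \<omega>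
  proof -
    have "In i \<omega> + Out i \<omega> = (\<Sum>j\<in>UNIV. \<alpha> $ i $ j * V (t j) \<omega>)"
      unfolding In_def Out_def by (subst sum.union_disjoint[symmetric]) (auto intro: sum.cong)
    moreover have "(\<Sum>j\<in>UNIV. \<alpha> $ i $ j * (V (t j) \<omega> + D (t j) \<omega>)) = c $ i"
      using solution[OF that] lastY[OF that times]
      by (auto simp: bvp_solution_def boundary_op_def vec_eq_iff)
    ultimately show ?thesis by (simp add: distrib_left sum.distrib)
  qed
  \<comment> \<open>\<open>Z b\<close> is included because it carries \<open>Y a\<close> to
    \<open>Y b\<close>; it is inner noise, since its anchor is \<open>a\<close>. The remaining
    generators are the noise parts of the boundary conditions and of the observed values, sorted by
    side.\<close>
  define G1 where "G1 = sigma (space P) (generators (space P) Z {b} \<union>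
    (generators (space P) In UNIV \<union> generators (space P) V (T \<inter> {a..b})))"
  define G2 where "G2 = sigma (space P) (generators (space P) Out UNIV \<union> generators (space P) V (T - {a..b}))"
  have spG: "space G1 = space P" "space G2 = space P"
    by (simp_all add: G1_def G2_def space_measure_of_conv)
  have sub_G1: "subalgebra M G1" if M: "space M = space P" and *: "Z b \<in> borel_measurable M"
    "\<And>i. In i \<in> borel_measurable M" "\<And>r. r \<in> T \<inter> {a..b} \<Longrightarrow> V r \<in> borel_measurable M" for M
    unfolding G1_def M[symmetric] using * by (intro subalgebra_sigma Un_least generators_subset_sets) auto
  have sub_G2: "subalgebra M G2" if M: "space M = space P" and *:
    "\<And>i. Out i \<in> borel_measurable M" "\<And>r. r \<in> T - {a..b} \<Longrightarrow> V r \<in> borel_measurable M" for M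
    unfolding G2_def M[symmetric] using * by (intro subalgebra_sigma Un_least generators_subset_sets) auto
  have V_N1: "V r \<in> borel_measurable N1" if "r \<in> {a..b}" for r
    unfolding V_def by (rule borel_measurable_last_comp[OF Z_N1[OF that]])
  have V_N2: "V r \<in> borel_measurable N2" if "r \<in> {0..1} - {a..b}" for r
    unfolding V_def by (rule borel_measurable_last_comp[OF Z_N2[OF that]])
  have N1G1: "subalgebra N1 G1"
    using V_N1 Z_N1[of b] ab spN by (intro sub_G1) (auto simp: In_def intro!: borel_measurable_sum borel_measurable_times)
  have N2G2: "subalgebra N2 G2"
    using V_N2 T times spN by (intro sub_G2) (auto simp: Out_def intro!: borel_measurable_sum borel_measurable_times)
  have D_meas: "D r \<in> borel_measurable M" if "Y a \<in> borel_measurable M" "Y b \<in> borel_measurable M" for M r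
    unfolding D_def using s_cases[of r] that
    by (intro borel_measurable_last_comp borel_measurable_matrix_vector_mult) auto

  \<comment> \<open>The noise fields lie in the conditioning field\<close>
  let ?G = "boundary_field (space P) Y a b T"
  have spGG: "space ?G = space P"
    by (simp add: boundary_field_def space_measure_of_conv)
  have gen_Pow: "generators (space P) Y {a, b} \<union> generators (space P) (\<lambda>r \<omega>. last_comp (Y r \<omega>)) T \<subseteq> Pow (space P)"
    by (intro Un_least generators_subset_Pow)
  have Y_G: "Y a \<in> borel_measurable ?G" "Y b \<in> borel_measurable ?G"
    unfolding boundary_field_def by (rule measurable_generators[OF _ Un_upper1 gen_Pow]; simp)+
  have lastY_G: "(\<lambda>\<omega>. last_comp (Y r \<omega>)) \<in> borel_measurable ?G" if "r \<in> T" for r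
    unfolding boundary_field_def
    by (rule measurable_generators[where X = "\<lambda>r \<omega>. last_comp (Y r \<omega>)", OF that Un_upper2 gen_Pow])
  have D_G: "D r \<in> borel_measurable ?G" for r
    by (rule D_meas[OF Y_G])
  have V_G: "V r \<in> borel_measurable ?G" if "r \<in> T" for r
  proof -
    have "(\<lambda>\<omega>. last_comp (Y r \<omega>) - D r \<omega>) \<in> borel_measurable ?G"
      by (intro borel_measurable_diff lastY_G D_G that)
    moreover have "last_comp (Y r \<omega>) - D r \<omega> = V r \<omega>" if "\<omega> \<in> space ?G" for \<omega>
      using lastY[of \<omega> r] that \<open>r \<in> T\<close> T spGG by auto
    ultimately show ?thesis by (simp cong: measurable_cong)
  qed
  have Zb_G: "Z b \<in> borel_measurable ?G"
  proof -
    have "(\<lambda>\<omega>. Y b \<omega> - \<Phi> b *v (\<Psi> a *v Y a \<omega>)) \<in> borel_measurable ?G"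
      by (intro borel_measurable_diff borel_measurable_matrix_vector_mult Y_G)
    moreover have "Y b \<omega> - \<Phi> b *v (\<Psi> a *v Y a \<omega>) = Z b \<omega>" if "\<omega> \<in> space ?G" for \<omega>
      using Y[of \<omega> b] that b01 spGG s_le[of b] by auto
    ultimately show ?thesis by (simp cong: measurable_cong)
  qed
  have sum_G: "(\<lambda>\<omega>. \<Sum>j\<in>J. \<alpha> $ i $ j * V (t j) \<omega>) \<in> borel_measurable ?G"
    if J: "\<And>j. j \<in> J \<Longrightarrow> \<alpha> $ i $ j \<noteq> 0 \<Longrightarrow> t j \<in> T" for i J
  proof (rule borel_measurable_sum)
    show "(\<lambda>\<omega>. \<alpha> $ i $ j * V (t j) \<omega>) \<in> borel_measurable ?G" if "j \<in> J" for j
      using V_G[of "t j"] J[OF that] by (cases "\<alpha> $ i $ j = 0") auto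
  qed
  have t_ab: "t j \<noteq> a" "t j \<noteq> b" "t j \<in> supp \<alpha> t i" if "\<alpha> $ i $ j \<noteq> 0" for i j
    using that ab_supp unfolding supp_def by auto
  \<comment> \<open>On the observed side the noise sum is measurable directly, the endpoints having
    coefficient zero. The other side follows from \<open>In_Out\<close>, whose right-hand side
    depends on \<open>Y a\<close> and \<open>Y b\<close> only.\<close>
  have In_Out_G: "In i \<in> borel_measurable ?G \<and> Out i \<in> borel_measurable ?G" for i
  proof -
    have sum: "(\<lambda>\<omega>. c $ i - (\<Sum>j\<in>UNIV. \<alpha> $ i $ j * D (t j) \<omega>)) \<in> borel_measurable ?G"
      by (intro borel_measurable_diff borel_measurable_sum borel_measurable_times borel_measurable_const D_G)
    show ?thesis
      using split[of i]
    proof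
      assume *: "supp \<alpha> t i \<inter> {a<..<b} \<subseteq> T"
      have "In i \<in> borel_measurable ?G"
        unfolding In_def using * t_ab by (intro sum_G) fastforce
      moreover from borel_measurable_diff[OF sum this] have "Out i \<in> borel_measurable ?G"
        by (rule measurable_cong[THEN iffD1, rotated]) (use In_Out[of _ i] spGG in \<open>simp add: algebra_simps\<close>)
      ultimately show ?thesis ..
    next
      assume *: "supp \<alpha> t i \<inter> ({0..1} - {a..b}) \<subseteq> T"
      have "Out i \<in> borel_measurable ?G"
        unfolding Out_def using * t_ab times by (intro sum_G) blast
      moreover from borel_measurable_diff[OF sum this] have "In i \<in> borel_measurable ?G"
        by (rule measurable_cong[THEN iffD1, rotated]) (use In_Out[of _ i] spGG in \<open>simp add: algebra_simps\<close>)
      ultimately show ?thesis by blast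
    qed
  qed

  \<comment> \<open>Recovery of the conditioning field from the noise fields\<close>
  let ?J = "join_field G1 G2"
  have spJ: "space ?J = space P" using space_join_field[of G2 G1] spG by simp
  have GJ: "subalgebra ?G ?J"
    using In_Out_G V_G Zb_G spGG
    by (intro subalgebra_join_field sub_G1 sub_G2) auto
  have J1: "subalgebra ?J G1" and J2: "subalgebra ?J G2"
    using subalgebra_join_field_left[of G2 G1] subalgebra_join_field_right[of G2 G1] spG by auto
  have Pow1: "generators (space P) Z {b} \<union>
    (generators (space P) In UNIV \<union> generators (space P) V (T \<inter> {a..b})) \<subseteq> Pow (space P)"
    by (intro Un_least generators_subset_Pow)
  have Pow2: "generators (space P) Out UNIV \<union> generators (space P) V (T - {a..b}) \<subseteq> Pow (space P)"
    by (intro Un_least generators_subset_Pow)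
  have Zb_J: "Z b \<in> borel_measurable ?J"
    by (rule measurable_from_subalg[OF J1], unfold G1_def, rule measurable_generators[OF _ _ Pow1]) auto
  have In_J: "In i \<in> borel_measurable ?J" for i
    by (rule measurable_from_subalg[OF J1], unfold G1_def, rule measurable_generators[where I = UNIV, OF _ _ Pow1]) auto
  have Out_J: "Out i \<in> borel_measurable ?J" for i
    by (rule measurable_from_subalg[OF J2], unfold G2_def, rule measurable_generators[where I = UNIV, OF _ _ Pow2]) auto
  have V_J: "V r \<in> borel_measurable ?J" if "r \<in> T" for r
  proof (cases "r \<in> {a..b}")
    case True
    then show ?thesis using that
      by (intro measurable_from_subalg[OF J1], unfold G1_def, intro measurable_generators[where I = "T \<inter> {a..b}", OF _ _ Pow1]) auto
  next
    case False
    then show ?thesis using that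
      by (intro measurable_from_subalg[OF J2], unfold G2_def, intro measurable_generators[where I = "T - {a..b}", OF _ _ Pow2]) auto
  qed
  \<comment> \<open>Well-posedness makes \<open>L\<close> invertible, so that the boundary condition can be solved for \<open>Y a\<close>.\<close>
  define L where "L v = boundary_op \<alpha> t (\<lambda>r. \<Phi> r *v (\<Psi> a *v v))" for v
  have "linear L"
    unfolding L_def boundary_op_def last_comp_def
    by (rule linearI) (simp_all add: vec_eq_iff matrix_vector_right_distrib matrix_vector_mult_scaleR
        distrib_left sum.distrib sum_distrib_left mult_ac)
  moreover have "v = 0" if "L v = 0" for v
  proof -
    have "\<Phi> a *v (\<Psi> a *v v) = 0"
      using well_posed homogeneous_solution[where \<Lambda> = "boundary_op \<alpha> t" and v = "\<Psi> a *v v", OF A \<Phi> that[unfolded L_def]] a01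
      unfolding well_posed_def by blast
    then show "v = 0" by (simp add: matrix_vector_mul_assoc \<Phi>\<Psi>[OF a01])
  qed
  ultimately obtain L' where L': "linear L'" "L' \<circ> L = id"
    using linear_injective_left_inverse[of L] linear_injective_0[of L] by blast
  \<comment> \<open>Times beyond \<open>b\<close> are anchored at \<open>b\<close>. Expressing
    \<open>Y b\<close> through \<open>Y a\<close> adds the noise \<open>Z b\<close>, and
    \<open>E j\<close> is its contribution at time \<open>t j\<close>; it vanishes for times
    anchored at \<open>a\<close>.\<close>
  define E where "E j = (\<lambda>\<omega>. (if s (t j) = a then 0 else last_comp (\<Phi> (t j) *v (\<Psi> b *v Z b \<omega>))))" for j
  have E_J: "E j \<in> borel_measurable ?J" for j
    using borel_measurable_last_comp[OF borel_measurable_matrix_vector_mult[OF borel_measurable_matrix_vector_mult[OF Zb_J]]]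
    by (cases "s (t j) = a") (simp_all add: E_def)
  \<comment> \<open>The boundary condition with all noise moved to the right: applying
    \<open>L'\<close> gives \<open>Y a\<close> as a function of generators of
    \<open>?J\<close>.\<close>
  have L_Ya: "L (Y a \<omega>) = (\<chi> i. c $ i - In i \<omega> - Out i \<omega> + (- (\<Sum>j\<in>UNIV. \<alpha> $ i $ j * E j \<omega>)))"
    if \<omega>: "\<omega> \<in> space P" for \<omega>
  proof -
    have "\<Psi> b *v Y b \<omega> = \<Psi> b *v Z b \<omega> + \<Psi> a *v Y a \<omega>"
      using Y[OF \<omega> b01] s_le[of b]
      by (simp add: matrix_vector_right_distrib matrix_vector_mul_assoc[of "\<Psi> b"] \<Psi>\<Phi>[OF b01])
    then have "D (t j) \<omega> = last_comp (\<Phi> (t j) *v (\<Psi> a *v Y a \<omega>)) + E j \<omega>" for j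
      using s_cases[of "t j"] ab
      by (auto simp: D_def E_def matrix_vector_right_distrib last_comp_add)
    then show ?thesis
      using In_Out[OF \<omega>] by (simp add: L_def boundary_op_def vec_eq_iff distrib_left sum.distrib algebra_simps)
  qed
  have Ya_J: "Y a \<in> borel_measurable ?J"
  proof -
    have L'_meas: "L' \<in> borel_measurable borel"
      using L'(1) by (intro borel_measurable_continuous_onI linear_continuous_on) (simp add: linear_conv_bounded_linear)
    have "(\<lambda>\<omega>. \<chi> i. c $ i - In i \<omega> - Out i \<omega> + (- (\<Sum>j\<in>UNIV. \<alpha> $ i $ j * E j \<omega>))) \<in> borel_measurable ?J"
      by (intro borel_measurable_vec_lambda borel_measurable_add borel_measurable_diff borel_measurable_uminus
          borel_measurable_sum borel_measurable_times borel_measurable_const In_J Out_J E_J)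
    from measurable_compose[OF this L'_meas]
    have "(\<lambda>\<omega>. L' (\<chi> i. c $ i - In i \<omega> - Out i \<omega> + (- (\<Sum>j\<in>UNIV. \<alpha> $ i $ j * E j \<omega>)))) \<in> borel_measurable ?J" .
    moreover have "L' (\<chi> i. c $ i - In i \<omega> - Out i \<omega> + (- (\<Sum>j\<in>UNIV. \<alpha> $ i $ j * E j \<omega>))) = Y a \<omega>"
      if "\<omega> \<in> space ?J" for \<omega>
      using fun_cong[OF L'(2), of "Y a \<omega>"] L_Ya[of \<omega>] that spJ by simp
    ultimately show ?thesis by (simp cong: measurable_cong)
  qed
  have Y_decomp: "Y r \<in> borel_measurable M"
    if M: "space M = space P" and r: "r \<in> {0..1}" and *: "Z r \<in> borel_measurable M" "Y (s r) \<in> borel_measurable M" for M r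
  proof -
    have "(\<lambda>\<omega>. Z r \<omega> + \<Phi> r *v (\<Psi> (s r) *v Y (s r) \<omega>)) \<in> borel_measurable M"
      by (intro borel_measurable_add borel_measurable_matrix_vector_mult *)
    then show ?thesis
      by (rule measurable_cong[THEN iffD2, rotated]) (use Y[OF _ r] M in simp)
  qed
  have Yb_J: "Y b \<in> borel_measurable ?J"
    using Y_decomp[OF spJ b01 Zb_J] Ya_J s_le[of b] by simp
  have "subalgebra ?J ?G"
    unfolding boundary_field_def spJ[symmetric]
  proof (intro subalgebra_sigma Un_least generators_subset_sets)
    show "Y r \<in> borel_measurable ?J" if "r \<in> {a, b}" for r using that Ya_J Yb_J by auto
    fix r assume r: "r \<in> T"
    have "(\<lambda>\<omega>. V r \<omega> + D r \<omega>) \<in> borel_measurable ?J"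
      by (intro borel_measurable_add V_J r D_meas Ya_J Yb_J)
    then show "(\<lambda>\<omega>. last_comp (Y r \<omega>)) \<in> borel_measurable ?J"
      by (rule measurable_cong[THEN iffD2, rotated]) (use lastY spJ r T in auto)
  qed
  then have G_eq: "sets ?G = sets ?J" using GJ by (auto simp: subalgebra_def)

  \<comment> \<open>The inner and outer solution fields\<close>
  have F1: "subalgebra (join_field N1 G2) N1" "subalgebra (join_field N1 G2) G2"
    using subalgebra_join_field_left[of G2 N1] subalgebra_join_field_right[of G2 N1] spN spG by auto
  \<comment> \<open>As \<open>G1\<close> is contained in \<open>N1\<close>, adjoining
    \<open>G2\<close> alone makes the state \<open>Y a\<close> available next to all inner
    noise.\<close>
  have F2: "subalgebra (join_field N1 G2) ?J"
    by (rule subalgebra_join_field[OF subalgebra_trans[OF F1(1) N1G1] F1(2)])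
  have spF: "space (join_field N1 G2) = space P" using space_join_field[of G2 N1] spN spG by simp
  have F: "subalgebra (join_field N1 G2) (sigma (space P) (generators (space P) Y {a..b}))"
    unfolding spF[symmetric]
  proof (intro subalgebra_sigma generators_subset_sets)
    fix r assume r: "r \<in> {a..b}"
    show "Y r \<in> borel_measurable (join_field N1 G2)"
    proof (rule Y_decomp[OF spF])
      show "r \<in> {0..1}" using r ab by auto
      show "Z r \<in> borel_measurable (join_field N1 G2)"
        by (rule measurable_from_subalg[OF F1(1) Z_N1[OF r]])
      show "Y (s r) \<in> borel_measurable (join_field N1 G2)"
        using measurable_from_subalg[OF F2 Ya_J] s_le[of r] r by simp
    qed
  qed
  have H1: "subalgebra (join_field N2 G1) N2" "subalgebra (join_field N2 G1) G1"
    using subalgebra_join_field_left[of G1 N2] subalgebra_join_field_right[of G1 N2] spN spG by auto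
  have H2: "subalgebra (join_field N2 G1) ?J"
    by (rule subalgebra_join_field[OF H1(2) subalgebra_trans[OF H1(1) N2G2]])
  have spH: "space (join_field N2 G1) = space P" using space_join_field[of G1 N2] spN spG by simp
  have H: "subalgebra (join_field N2 G1) (sigma (space P) (generators (space P) Y ({0..1} - {a<..<b})))"
    unfolding spH[symmetric]
  proof (intro subalgebra_sigma generators_subset_sets)
    note Yab = measurable_from_subalg[OF H2 Ya_J] measurable_from_subalg[OF H2 Yb_J]
    fix r assume r: "r \<in> {0..1} - {a<..<b}"
    show "Y r \<in> borel_measurable (join_field N2 G1)"
    \<comment> \<open>The endpoints belong to the outer part of the solution but not to the outer
      increments; their values come from \<open>?J\<close>.\<close>
    proof (cases "r = a \<or> r = b")
      case True
      then show ?thesis using Yab by auto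
    next
      case False
      with r have r': "r \<in> {0..1} - {a..b}" by auto
      show ?thesis
      proof (rule Y_decomp[OF spH])
        show "r \<in> {0..1}" using r by auto
        show "Z r \<in> borel_measurable (join_field N2 G1)" by (rule measurable_from_subalg[OF H1(1) Z_N2[OF r']])
        show "Y (s r) \<in> borel_measurable (join_field N2 G1)" using s_cases[of r] Yab by auto
      qed
    qed
  qed
  show ?thesis
    by (rule cond_indep_join_field[OF indep subN N1G1 N2G2 spGG G_eq F H])
qed

section \<open>The two choices of observed times\<close>

theorem theorem4p10:
  fixes P :: "(real \<Rightarrow> real) measure"
    and coef :: "nat \<Rightarrow> real \<Rightarrow> real"
    and \<alpha> :: "real ^ 'm::{finite,linorder} ^ 'n::{finite,linorder}"
    and t :: "'m::{finite,linorder} \<Rightarrow> real"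
    and c :: "real ^ 'n::{finite,linorder}"
    and Y :: "real \<Rightarrow> (real \<Rightarrow> real) \<Rightarrow> real ^ 'n::{finite,linorder}"
    and a b :: real
  assumes wiener: "wiener_measure P"
    and coef: "\<And>k. k < CARD('n) \<Longrightarrow> continuous_on {0..1} (coef k)"
    and dims: "CARD('n) \<le> CARD('m)"
    and times: "strict_mono t" "\<And>j. 0 \<le> t j \<and> t j \<le> 1"
    and full_rank: "rank \<alpha> = CARD('n)"
    and basic: "basic_form \<alpha>"
    and well_posed: "well_posed (companion_matrix coef) (boundary_op \<alpha> t)"
    and solution: "\<And>\<omega>. \<omega> \<in> space P \<Longrightarrow>
      bvp_solution (companion_matrix coef) (forcing \<omega>) (boundary_op \<alpha> t) c (\<lambda>s. Y s \<omega>)"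
    and ab: "0 \<le> a" "a < b" "b \<le> 1"
    and ab_supp: "a \<notin> (\<Union>i. supp \<alpha> t i)" "b \<notin> (\<Union>i. supp \<alpha> t i)"
  shows "cond_indep P
           (boundary_field (space P) Y a b (splitting_times \<alpha> t a b {a<..<b}))
           (sigma (space P) (generators (space P) Y {a..b}))
           (sigma (space P) (generators (space P) Y ({0..1} - {a<..<b})))
       \<and> cond_indep P
           (boundary_field (space P) Y a b (splitting_times \<alpha> t a b ({0..1} - {a..b})))
           (sigma (space P) (generators (space P) Y {a..b}))
           (sigma (space P) (generators (space P) Y ({0..1} - {a<..<b})))"
proof -
  have A: "continuous_on {0..1} (companion_matrix coef :: real \<Rightarrow> real ^ 'n::{finite,linorder} ^ 'n::{finite,linorder})"
    by (rule continuous_on_companion_matrix[OF coef])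
  have t: "t j \<in> {0..1}" for j using times(2)[of j] by simp
  \<comment> \<open>A preserving condition has no times on one of the two sides, so the splitting
    requirement holds there with nothing observed.\<close>
  have preserved: "supp \<alpha> t i \<inter> {a<..<b} = {} \<or> supp \<alpha> t i \<inter> ({0..1} - {a..b}) = {}"
    if "preserves (supp \<alpha> t i) a b" for i
    using that unfolding preserves_def by fastforce
  \<comment> \<open>For any other condition all times on the chosen side are observed, whichever
    side \<open>D\<close> is.\<close>
  have mixed: "supp \<alpha> t i \<inter> D \<subseteq> splitting_times \<alpha> t a b D"
    if "\<not> preserves (supp \<alpha> t i) a b" for i D
    using that unfolding splitting_times_def by blast
  have sub: "splitting_times \<alpha> t a b D \<subseteq> D" for D
    unfolding splitting_times_def by blast
  have 1: "splitting_times \<alpha> t a b {a<..<b} \<subseteq> {0..1}"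
    and 2: "splitting_times \<alpha> t a b ({0..1} - {a..b}) \<subseteq> {0..1}"
    using sub[of "{a<..<b}"] sub[of "{0..1} - {a..b}"] ab by fastforce+
  have split1: "supp \<alpha> t i \<inter> {a<..<b} \<subseteq> splitting_times \<alpha> t a b {a<..<b} \<or>
      supp \<alpha> t i \<inter> ({0..1} - {a..b}) \<subseteq> splitting_times \<alpha> t a b {a<..<b}" for i
    using preserved[of i] mixed[of i "{a<..<b}"] by (metis empty_subsetI)
  have split2: "supp \<alpha> t i \<inter> {a<..<b} \<subseteq> splitting_times \<alpha> t a b ({0..1} - {a..b}) \<or>
      supp \<alpha> t i \<inter> ({0..1} - {a..b}) \<subseteq> splitting_times \<alpha> t a b ({0..1} - {a..b})" for i
    using preserved[of i] mixed[of i "{0..1} - {a..b}"] by (metis empty_subsetI)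
  show ?thesis
    using cond_indep_splitting[OF wiener A t well_posed solution ab ab_supp 1 split1]
      cond_indep_splitting[OF wiener A t well_posed solution ab ab_supp 2 split2] ..
qed

end
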